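(* Let $1\le M\le N$ and $h>0$, and let $q$ and $r$ be the quotient and remainder of the division of $N$ by $M$. Then there exists an optimal order $\mathbf{S}^*$ of $M$ transmitters and $N$ receivers whose vector $\mathbf{N}^*=(n_{H_lT_1},n_{T_1T_2},\dots,n_{T_{M-1}T_M},n_{T_MH_r})$ is: (i) if $q$ is even, $\mathbf{N}^*=\bigl(\tfrac q2,\underbrace{q+1,\dots,q+1}_{r},\underbrace{q,\dots,q}_{M-1-r},\tfrac q2\bigr)$; (ii) if $q$ is odd and $r=0$, $\mathbf{N}^*=\bigl(\tfrac{q+1}2,\underbrace{q,\dots,q}_{M-1},\tfrac{q-1}2\bigr)$; (iii) if $q$ is odd and $r\ge1$, $\mathbf{N}^*=\bigl(\tfrac{q+1}2,\underbrace{q+1,\dots,q+1}_{r-1},\underbrace{q,\dots,q}_{M-r},\tfrac{q+1}2\bigr)$.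
   Context: All points lie on a line. There are $M$ transmitters (type $T$) and $N$ receivers (type $R$), $J=M+N$, and two virtual end nodes $H_l$ (leftmost) and $H_r$ (rightmost). A (deployment) order is a sequence $\mathbf{S}=(H_l,S_1,\dots,S_J,H_r)$ where $(S_1,\dots,S_J)$ is a permutation of the set of all transmitters and receivers, listed from left to right: $0\le\|H_lS_1\|\le\cdots\le\|H_lS_J\|\le\|H_lH_r\|$. Its spacings are the nonnegative distances between neighbors, $\mathbf{D}_{\mathbf{S}}=(\|H_lS_1\|,\|S_1S_2\|,\dots,\|S_{J-1}S_J\|,\|S_JH_r\|)$. For a point $p$, $I(p)$ is the minimum of $\|T_ip\|\,\|R_jp\|$ over all transmitters $T_i$ and receivers $R_j$, and $Q(\overline{H_lH_r})=\max_{p\in\overline{H_lH_r}}I(p)$. An order $\mathbf{S}$ is optimal if, for some spacings with $\|H_lH_r\|=h$, it attains the minimum of $Q(\overline{H_lH_r})$ over all orders and all spacings satisfying $\|H_lH_r\|=h$. Transmitters are indexed in their left-to-right order $T_1,\dots,T_M$ in $\mathbf{S}$; $n_{H_lT_1}$, $n_{T_iT_{i+1}}$, $n_{T_MH_r}$ denote the number of receivers in the order $\mathbf{S}$ between $H_l$ and $T_1$, between $T_i$ and $T_{i+1}$, and between $T_M$ and $H_r$, respectively. *)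

theory Defs
  imports Complex_Main "HOL-Combinatorics.Multiset_Permutations"
begin

datatype node =
    is_Hl: Hl
  | is_Hr: Hr
  | is_Trans: Trans nat
  | is_Recv: Recv nat

definition nodes :: "nat \<Rightarrow> nat \<Rightarrow> node set" where
  "nodes M N = Trans ` {..<M} \<union> Recv ` {..<N}"

definition orders :: "nat \<Rightarrow> nat \<Rightarrow> node list set" where
  "orders M N = {Hl # s @ [Hr] | s. s \<in> permutations_of_set (nodes M N)}"

text \<open>Nonnegative spacings \<open>D ! 0, \<dots>, D ! J\<close> for \<open>J\<close> nodes between end nodes at distance \<open>h\<close>.\<close>

definition spacings :: "nat \<Rightarrow> real \<Rightarrow> real list set" where
  "spacings J h = {D. length D = J + 1 \<and> (\<forall>d\<in>set D. 0 \<le> d) \<and> sum_list D = h}"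

text \<open>The coordinate of the \<open>k\<close>-th entry of an order, with \<open>Hl\<close> (entry 0) placed at the origin.\<close>

definition loc :: "real list \<Rightarrow> nat \<Rightarrow> real" where
  "loc D k = sum_list (take k D)"

definition I_val :: "node list \<Rightarrow> real list \<Rightarrow> real \<Rightarrow> real" where
  "I_val S D p = Min {\<bar>loc D i - p\<bar> * \<bar>loc D j - p\<bar> | i j.
     i < length S \<and> j < length S \<and> is_Trans (S ! i) \<and> is_Recv (S ! j)}"

text \<open>The supremum is a maximum, see \<open>Q_val_attained\<close> below.\<close>

definition Q_val :: "node list \<Rightarrow> real list \<Rightarrow> real" where
  "Q_val S D = (SUP p\<in>{0..sum_list D}. I_val S D p)"

definition optimal_order :: "nat \<Rightarrow> nat \<Rightarrow> real \<Rightarrow> node list \<Rightarrow> bool" where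
  "optimal_order M N h S \<longleftrightarrow> S \<in> orders M N \<and>
     (\<exists>D\<in>spacings (M + N) h. \<forall>S'\<in>orders M N. \<forall>D'\<in>spacings (M + N) h.
        Q_val S D \<le> Q_val S' D')"

text \<open>The places in \<open>S\<close> of \<open>Hl\<close>, of the transmitters and of \<open>Hr\<close>, from left to right.\<close>

definition fences :: "node list \<Rightarrow> nat list" where
  "fences S = filter (\<lambda>k. is_Hl (S ! k) \<or> is_Trans (S ! k) \<or> is_Hr (S ! k)) [0..<length S]"

definition receiver_counts :: "node list \<Rightarrow> nat list" where
  "receiver_counts S =
     map (\<lambda>i. card {k. fences S ! i < k \<and> k < fences S ! (i + 1) \<and> is_Recv (S ! k)})
       [0..<length (fences S) - 1]"

lemma continuous_on_Min_finite:
  fixes f :: "'i \<Rightarrow> real \<Rightarrow> real"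
  assumes "finite A" "A \<noteq> {}" "\<And>i. i \<in> A \<Longrightarrow> continuous_on X (f i)"
  shows "continuous_on X (\<lambda>x. Min ((\<lambda>i. f i x) ` A))"
  using assms by (induction A rule: finite_ne_induct) (auto intro!: continuous_on_min)

lemma Q_val_attained:
  assumes "1 \<le> M" "1 \<le> N" "S \<in> orders M N" "D \<in> spacings J h" "0 \<le> h"
  shows "\<exists>p\<in>{0..h}. Q_val S D = I_val S D p \<and> (\<forall>p'\<in>{0..h}. I_val S D p' \<le> I_val S D p)"
proof -
  let ?A = "{(i, j). i < length S \<and> j < length S \<and> is_Trans (S ! i) \<and> is_Recv (S ! j)}"
  have "finite ?A"
    by (rule finite_subset[of _ "{..<length S} \<times> {..<length S}"]) auto
  moreover have "?A \<noteq> {}"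
  proof -
    have "Trans 0 \<in> set S" "Recv 0 \<in> set S"
      using assms by (auto simp: orders_def nodes_def permutations_of_set_def)
    then obtain i j where "i < length S" "S ! i = Trans 0" "j < length S" "S ! j = Recv 0"
      by (auto simp: in_set_conv_nth)
    then have "(i, j) \<in> ?A" by auto
    then show ?thesis by blast
  qed
  ultimately have "continuous_on {0..h}
      (\<lambda>p. Min ((\<lambda>a. \<bar>loc D (fst a) - p\<bar> * \<bar>loc D (snd a) - p\<bar>) ` ?A))"
    by (rule continuous_on_Min_finite) (intro continuous_intros)
  moreover have "I_val S D p = Min ((\<lambda>a. \<bar>loc D (fst a) - p\<bar> * \<bar>loc D (snd a) - p\<bar>) ` ?A)" for p
    unfolding I_val_def by (rule arg_cong[where f = Min]) force
  ultimately have "continuous_on {0..h} (I_val S D)" by presburger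
  then obtain p where p: "p \<in> {0..h}" "\<forall>p'\<in>{0..h}. I_val S D p' \<le> I_val S D p"
    using continuous_attains_sup[of "{0..h}" "I_val S D"] assms(5) by auto
  have "(SUP p\<in>{0..h}. I_val S D p) = I_val S D p"
    using p by (intro cSup_eq_maximum) auto
  then show ?thesis
    using p assms(4) by (auto simp: Q_val_def spacings_def)
qed

end

theory Submission
  imports Defs
begin

text \<open>
  By scaling, minimizing \<open>Q\<close> for a given length is the same as maximizing the length on which
  \<open>I \<le> c\<^sup>2\<close> for a given \<open>c\<close>. If the \<open>k\<close>-th receiver next to a transmitter lies at
  distance \<open>x\<^sub>k\<close> from it, the midpoint of a gap forces \<open>x\<^sub>k\<^sub>+\<^sub>1\<^sup>2 \<le> x\<^sub>k\<^sup>2 + 4 c\<^sup>2\<close>, even if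
  every transmitter also counted as a receiver. Hence \<open>n\<close> receivers between two transmitters
  allow a distance of at most \<open>2 c (sqrt i + sqrt j)\<close> for some \<open>i + j = n + 1\<close>, and \<open>n\<close> receivers
  at an end allow \<open>c (sqrt n + sqrt (n + 1))\<close>. Bounding the square root by a suitable affine
  function and adding up shows that the receiver counts of the theorem are best for these bounds,
  and ladders \<open>x\<^sub>k = 2 c sqrt k\<close> attain them as soon as every count is positive. This leaves
  \<open>M = N\<close>, where the bounds are not attained: there, two neighbours of the same type cost
  \<open>(2 - sqrt 2) c\<close> compared to the bounds, while alternating orders are bounded directly, using
  both points nearest to each end.
\<close>

subsection \<open>Bounds on the covered length\<close>

text \<open>A concave function lies below the line through two of its points outside the interval
  between them, and no natural number lies strictly between \<open>k\<close> and
  \<open>k + 1\<close>.\<close>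

lemma sqrt_secant:
  fixes i k :: nat
  shows "sqrt i \<le> sqrt k + (sqrt (k + 1) - sqrt k) * (real i - real k)"
proof -
  define s a b where "s = sqrt i" and "a = sqrt k" and "b = sqrt (real k + 1)"
  have nonneg: "0 \<le> s" "0 \<le> a" "0 < b"
    by (auto simp: s_def a_def b_def)
  have sq: "s\<^sup>2 = real i" "a\<^sup>2 = real k" "b\<^sup>2 = real k + 1"
    by (auto simp: s_def a_def b_def)
  have "0 \<le> (s - a) * (s - b)"
  proof (cases "i \<le> k")
    case True
    then have "s \<le> a" "a \<le> b" by (auto simp: s_def a_def b_def)
    then show ?thesis by (simp add: mult_nonpos_nonpos)
  next
    case False
    then have "a \<le> b" "b \<le> s" by (auto simp: s_def a_def b_def)
    then show ?thesis by simp
  qed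
  then have "(s - a) * (b + a) \<le> (s - a) * (s + a)"
    by (simp add: algebra_simps)
  also have "\<dots> = real i - real k"
    using sq by (simp add: algebra_simps power2_eq_square)
  finally have "(b - a) * ((s - a) * (b + a)) \<le> (b - a) * (real i - real k)"
    by (intro mult_left_mono) (auto simp: a_def b_def)
  moreover have "(b - a) * ((s - a) * (b + a)) = (s - a) * (b\<^sup>2 - a\<^sup>2)"
    by (simp add: algebra_simps power2_eq_square)
  ultimately have "s - a \<le> (b - a) * (real i - real k)"
    using sq by simp
  then show ?thesis
    unfolding s_def a_def b_def by (simp add: algebra_simps)
qed

text \<open>The squares telescope: each step adds at most \<open>4 * c\<^sup>2\<close>.\<close>

lemma ladder_bound:
  fixes g :: "nat \<Rightarrow> real"
  assumes "g 0 = 0" "0 \<le> c"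
    and step: "\<And>k. k < n \<Longrightarrow> (g (Suc k))\<^sup>2 \<le> (g k)\<^sup>2 + 4 * c\<^sup>2"
  shows "g n \<le> 2 * c * sqrt n"
proof -
  have "k \<le> n \<Longrightarrow> (g k)\<^sup>2 \<le> 4 * c\<^sup>2 * k" for k
  proof (induction k)
    case (Suc k)
    then show ?case using step[of k] by (simp add: algebra_simps)
  qed (use assms in simp)
  then have "(g n)\<^sup>2 \<le> (2 * c * sqrt n)\<^sup>2"
    by (simp add: power_mult_distrib)
  then show ?thesis
    by (rule power2_le_imp_le) (use assms(2) in auto)
qed

text \<open>The positive root \<open>u\<close> of \<open>u * (u - 2 * sqrt n) = 1\<close>. For
  \<open>c = 1\<close> it is the distance of an end node from the outermost transmitter when the
  outermost of \<open>n\<close> receivers lies at \<open>2 * sqrt n\<close> from that transmitter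
  and the end node is just covered.\<close>

definition end_len :: "nat \<Rightarrow> real" where
  "end_len n = sqrt n + sqrt (n + 1)"

text \<open>\<open>T\<close> holds the indices of the transmitters; the other indices in \<open>1, \<dots>, J\<close> are receivers,
  and \<open>0\<close> and \<open>J + 1\<close> are the end nodes.\<close>

locale deployment =
  fixes x :: "nat \<Rightarrow> real" and J :: nat and T :: "nat set" and c :: real
  assumes mono: "\<And>i j. i \<le> j \<Longrightarrow> j \<le> Suc J \<Longrightarrow> x i \<le> x j"
    and x_0: "x 0 = 0"
    and T_subset: "T \<subseteq> {1..J}"
    and c_nonneg: "0 \<le> c"
    and covered: "\<And>p. 0 \<le> p \<Longrightarrow> p \<le> x (Suc J) \<Longrightarrow>
      \<exists>i\<in>T. \<exists>j\<in>{1..J} - T. \<bar>x i - p\<bar> * \<bar>x j - p\<bar> \<le> c\<^sup>2"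
begin

section \<open>Midpoints of gaps between neighbours\<close>

lemma far_from_midpoint:
  assumes "k \<le> J" "j \<le> Suc J"
  shows "(x (Suc k) - x k) / 2 \<le> \<bar>x j - (x k + x (Suc k)) / 2\<bar>"
proof (cases "j \<le> k")
  case True
  then show ?thesis using mono[of j k] assms by (simp add: abs_if field_simps)
next
  case False
  then show ?thesis using mono[of "Suc k" j] assms by (simp add: abs_if field_simps)
qed

text \<open>The receiver of the covering pair is estimated by the least distance that any node can
  have from the midpoint. Only the transmitter remains in the condition, as if every node could
  serve as a receiver.\<close>

lemma midpoint_covered:
  assumes "k \<le> J"
  obtains i where "i \<in> T"
    "\<bar>x i - (x k + x (Suc k)) / 2\<bar> * ((x (Suc k) - x k) / 2) \<le> c\<^sup>2"
proof -
  let ?m = "(x k + x (Suc k)) / 2"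
  have "0 \<le> ?m" "?m \<le> x (Suc J)"
    using mono[of 0 k] mono[of 0 "Suc k"] mono[of k "Suc J"] mono[of "Suc k" "Suc J"] x_0 assms
    by auto
  then obtain i j where ij: "i \<in> T" "j \<in> {1..J} - T" "\<bar>x i - ?m\<bar> * \<bar>x j - ?m\<bar> \<le> c\<^sup>2"
    using covered by blast
  have "\<bar>x i - ?m\<bar> * ((x (Suc k) - x k) / 2) \<le> \<bar>x i - ?m\<bar> * \<bar>x j - ?m\<bar>"
    using far_from_midpoint[of k j] ij(2) assms by (intro mult_left_mono) auto
  with ij that show thesis by force
qed

text \<open>Both factors of the covering pair are at least half the gap.\<close>

lemma gap_le:
  assumes "k \<le> J"
  shows "x (Suc k) - x k \<le> 2 * c"
proof -
  obtain i where i: "i \<in> T"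
    "\<bar>x i - (x k + x (Suc k)) / 2\<bar> * ((x (Suc k) - x k) / 2) \<le> c\<^sup>2"
    using midpoint_covered assms by blast
  have "(x (Suc k) - x k) / 2 * ((x (Suc k) - x k) / 2)
      \<le> \<bar>x i - (x k + x (Suc k)) / 2\<bar> * ((x (Suc k) - x k) / 2)"
    using far_from_midpoint[of k i] i(1) T_subset assms mono[of k "Suc k"]
    by (intro mult_right_mono) auto
  with i(2) have "((x (Suc k) - x k) / 2)\<^sup>2 \<le> c\<^sup>2"
    by (simp add: power2_eq_square)
  then show ?thesis
    using c_nonneg by (auto dest!: power2_le_imp_le)
qed

text \<open>By the hypotheses no transmitter is nearer to the midpoint than \<open>x a\<close>. The
  product of \<open>?m - x a\<close> and half the gap is a quarter of the difference of the two
  squares.\<close>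

lemma step_left:
  assumes "a \<le> k" "k \<le> J"
    and right: "\<And>i. i \<in> T \<Longrightarrow> k < i \<Longrightarrow>
      (x k + x (Suc k)) / 2 - x a \<le> x i - (x k + x (Suc k)) / 2"
    and left: "\<And>i. i \<in> T \<Longrightarrow> i \<le> k \<Longrightarrow> i \<le> a"
  shows "(x (Suc k) - x a)\<^sup>2 \<le> (x k - x a)\<^sup>2 + 4 * c\<^sup>2"
proof -
  let ?m = "(x k + x (Suc k)) / 2" and ?d = "(x (Suc k) - x k) / 2"
  obtain i where i: "i \<in> T" "\<bar>x i - ?m\<bar> * ?d \<le> c\<^sup>2"
    using midpoint_covered assms by blast
  have "?m - x a \<le> \<bar>x i - ?m\<bar>"
  proof (cases "i \<le> k")
    case True
    then have "x i \<le> x a" using left i mono[of i a] assms by auto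
    then show ?thesis by linarith
  next
    case False
    then show ?thesis using right[OF i(1)] by linarith
  qed
  then have "(?m - x a) * ?d \<le> \<bar>x i - ?m\<bar> * ?d"
    using mono[of k "Suc k"] assms by (intro mult_right_mono) auto
  with i(2) have "(?m - x a) * ?d \<le> c\<^sup>2" by simp
  then show ?thesis by (simp add: field_simps power2_eq_square)
qed

text \<open>Mirror image of \<open>step_left\<close>, with distances measured from
  \<open>x b\<close> to the left.\<close>

lemma step_right:
  assumes "k < b" "b \<le> J"
    and left: "\<And>i. i \<in> T \<Longrightarrow> i \<le> k \<Longrightarrow>
      x b - (x k + x (Suc k)) / 2 \<le> (x k + x (Suc k)) / 2 - x i"
    and right: "\<And>i. i \<in> T \<Longrightarrow> k < i \<Longrightarrow> b \<le> i"
  shows "(x b - x k)\<^sup>2 \<le> (x b - x (Suc k))\<^sup>2 + 4 * c\<^sup>2"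
proof -
  let ?m = "(x k + x (Suc k)) / 2" and ?d = "(x (Suc k) - x k) / 2"
  obtain i where i: "i \<in> T" "\<bar>x i - ?m\<bar> * ?d \<le> c\<^sup>2"
    using midpoint_covered[of k] assms by (metis le_trans less_imp_le)
  have "x b - ?m \<le> \<bar>x i - ?m\<bar>"
  proof (cases "i \<le> k")
    case True
    then show ?thesis using left[OF i(1) True] by linarith
  next
    case False
    then have "x b \<le> x i" using right i mono[of b i] T_subset by force
    then show ?thesis by linarith
  qed
  then have "(x b - ?m) * ?d \<le> \<bar>x i - ?m\<bar> * ?d"
    using mono[of k "Suc k"] assms by (intro mult_right_mono) auto
  with i(2) have "(x b - ?m) * ?d \<le> c\<^sup>2" by simp
  then show ?thesis by (simp add: field_simps power2_eq_square)
qed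

text \<open>Gaps whose midpoint lies left of \<open>mid\<close> have \<open>a\<close> as nearest
  transmitter and form a ladder rising from \<open>a\<close>; those with midpoint right of it form a
  ladder rising from \<open>b\<close>. The numbers of gaps in the two ladders are \<open>i\<close>
  and \<open>j\<close>.\<close>

lemma between_transmitters:
  assumes ab: "a \<in> T" "b \<in> T" "a < b" and between: "\<And>i. i \<in> T \<Longrightarrow> i \<le> a \<or> b \<le> i"
  obtains i j where "i + j = b - a" "x b - x a \<le> 2 * c * (sqrt i + sqrt j)"
proof -
  define mid where "mid = (x a + x b) / 2"
  have bJ: "b \<le> J" using ab T_subset by auto
  have xab: "x a \<le> x b" using mono[of a b] ab bJ by auto
  define K where "K = {k \<in> {a..<b}. x k \<le> mid}"
  have "finite K" "a \<in> K" using ab xab by (auto simp: K_def mid_def)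
  then have max: "Max K \<in> K" "\<And>k. k \<in> K \<Longrightarrow> k \<le> Max K"
    using Max_in Max_ge by blast+
  \<comment> \<open>The gap from \<open>k\<close> to \<open>Suc k\<close> is the one that contains
    \<open>mid\<close>.\<close>
  define k where "k = Max K"
  have k: "a \<le> k" "k < b" "x k \<le> mid" using max(1) by (auto simp: K_def k_def)
  have k': "mid \<le> x (Suc k)"
  proof (rule ccontr)
    assume "\<not> mid \<le> x (Suc k)"
    moreover have "mid \<le> x b" using xab by (simp add: mid_def)
    ultimately have "Suc k \<in> K" using k by (cases "Suc k = b") (auto simp: K_def)
    then show False using max(2) by (force simp: k_def)
  qed
  have left: "(x (Suc l) - x a)\<^sup>2 \<le> (x l - x a)\<^sup>2 + 4 * c\<^sup>2"
    if l: "a \<le> l" "l < b" "(x l + x (Suc l)) / 2 \<le> mid" for l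
  proof (rule step_left)
    fix i assume i: "i \<in> T" "l < i"
    then have "x b \<le> x i" using between[of i] l mono[of b i] T_subset by auto
    then show "(x l + x (Suc l)) / 2 - x a \<le> x i - (x l + x (Suc l)) / 2"
      using l(3) by (simp add: mid_def field_simps)
  next
    fix i assume "i \<in> T" "i \<le> l" then show "i \<le> a" using between[of i] l by auto
  qed (use l bJ in auto)
  have right: "(x b - x l)\<^sup>2 \<le> (x b - x (Suc l))\<^sup>2 + 4 * c\<^sup>2"
    if l: "a \<le> l" "l < b" "mid \<le> (x l + x (Suc l)) / 2" for l
  proof (rule step_right)
    fix i assume i: "i \<in> T" "i \<le> l"
    then have "x i \<le> x a" using between[of i] l mono[of i a] ab bJ by auto
    then show "x b - (x l + x (Suc l)) / 2 \<le> (x l + x (Suc l)) / 2 - x i"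
      using l(3) by (simp add: mid_def field_simps)
  next
    fix i assume "i \<in> T" "l < i" then show "b \<le> i" using between[of i] l by auto
  qed (use l bJ in auto)
  have below: "x l \<le> mid" if "l \<le> k" for l
    using mono[of l k] that k bJ by linarith
  have above: "mid \<le> x l" if "Suc k \<le> l" "l \<le> b" for l
    using mono[of "Suc k" l] that k' bJ by linarith
  have left_ladder: "x (a + n) - x a \<le> 2 * c * sqrt n"
    if "\<And>i. i < n \<Longrightarrow> a + i < b \<and> (x (a + i) + x (Suc (a + i))) / 2 \<le> mid" for n
    using ladder_bound[of "\<lambda>i. x (a + i) - x a" c n] c_nonneg left that by force
  have right_ladder: "x b - x (b - n) \<le> 2 * c * sqrt n"
    if n: "n \<le> b - a" "\<And>l. b - n \<le> l \<Longrightarrow> l < b \<Longrightarrow> mid \<le> (x l + x (Suc l)) / 2" for n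
  proof (rule ladder_bound[of "\<lambda>i. x b - x (b - i)" c n])
    fix i assume i: "i < n"
    with n(1) have "Suc (b - Suc i) = b - i" by auto
    then show "(x b - x (b - Suc i))\<^sup>2 \<le> (x b - x (b - i))\<^sup>2 + 4 * c\<^sup>2"
      using right[of "b - Suc i"] n(1) n(2)[of "b - Suc i"] i by auto
  qed (use c_nonneg in auto)
  \<comment> \<open>The gap around \<open>mid\<close> goes to the ladder on whose side its own
    midpoint lies.\<close>
  show thesis
  proof (cases "(x k + x (Suc k)) / 2 \<le> mid")
    case True
    have "x (a + (Suc k - a)) - x a \<le> 2 * c * sqrt (real (Suc k - a))"
    proof (rule left_ladder)
      fix i assume i: "i < Suc k - a"
      show "a + i < b \<and> (x (a + i) + x (Suc (a + i))) / 2 \<le> mid"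
      proof (cases "a + i = k")
        case True
        then show ?thesis using \<open>(x k + x (Suc k)) / 2 \<le> mid\<close> k by simp
      next
        case False
        then have "Suc (a + i) \<le> k" using i k by linarith
        then show ?thesis using below[of "a + i"] below[of "Suc (a + i)"] k by auto
      qed
    qed
    moreover have "x b - x (b - (b - Suc k)) \<le> 2 * c * sqrt (real (b - Suc k))"
    proof (rule right_ladder)
      fix l assume "b - (b - Suc k) \<le> l" "l < b"
      then show "mid \<le> (x l + x (Suc l)) / 2"
        using above[of l] above[of "Suc l"] k by auto
    qed (use k in auto)
    ultimately have "x b - x a \<le> 2 * c * (sqrt (real (Suc k - a)) + sqrt (real (b - Suc k)))"
      using k by (simp add: algebra_simps)
    then show thesis using that[of "Suc k - a" "b - Suc k"] k by auto
  next
    case False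
    have "x (a + (k - a)) - x a \<le> 2 * c * sqrt (real (k - a))"
    proof (rule left_ladder)
      fix i assume i: "i < k - a"
      then have "Suc (a + i) \<le> k" by linarith
      then show "a + i < b \<and> (x (a + i) + x (Suc (a + i))) / 2 \<le> mid"
        using below[of "a + i"] below[of "Suc (a + i)"] k by auto
    qed
    moreover have "x b - x (b - (b - k)) \<le> 2 * c * sqrt (real (b - k))"
    proof (rule right_ladder)
      fix l assume l: "b - (b - k) \<le> l" "l < b"
      show "mid \<le> (x l + x (Suc l)) / 2"
      proof (cases "l = k")
        case True
        then show ?thesis using False by simp
      next
        case False
        then show ?thesis using above[of l] above[of "Suc l"] k l by auto
      qed
    qed (use k in auto)
    ultimately have "x b - x a \<le> 2 * c * (sqrt (real (k - a)) + sqrt (real (b - k)))"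
      using k by (simp add: algebra_simps)
    then show thesis using that[of "k - a" "b - k"] k by auto
  qed
qed

text \<open>Here \<open>u\<close> is the distance from an end node to the outermost transmitter and
  \<open>v\<close> that from this transmitter to the outermost entry. After completing the square in
  \<open>u * (u - v)\<close>, the ladder bound on \<open>v\<close> is used both for
  \<open>v\<^sup>2 / 4\<close> and for \<open>v / 2\<close>.\<close>

lemma end_bound:
  assumes "v \<le> 2 * c * sqrt n" "0 \<le> v" "u * (u - v) \<le> c\<^sup>2"
  shows "u \<le> c * end_len n"
proof -
  have "v\<^sup>2 \<le> (2 * c * sqrt n)\<^sup>2"
    using assms by (intro power_mono) auto
  then have "v\<^sup>2 \<le> 4 * c\<^sup>2 * real n"
    by (simp add: power_mult_distrib)
  moreover have "(u - v / 2)\<^sup>2 = u * (u - v) + v\<^sup>2 / 4"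
    by (simp add: field_simps power2_eq_square)
  ultimately have "(u - v / 2)\<^sup>2 \<le> c\<^sup>2 * (real n + 1)"
    using assms(3) by (simp add: algebra_simps)
  also have "\<dots> = (c * sqrt (real n + 1))\<^sup>2"
    by (simp add: power_mult_distrib)
  finally have "u - v / 2 \<le> c * sqrt (real n + 1)"
    by (rule power2_le_imp_le) (use c_nonneg in auto)
  then show ?thesis
    using assms(1) by (simp add: end_len_def algebra_simps)
qed

text \<open>Seen from \<open>b\<close>, the \<open>b - 1\<close> receivers form a ladder that stops
  at entry 1, since the end node is no receiver. The remaining gap is limited by covering the point
  0: no transmitter is nearer than \<open>x b\<close> and no receiver nearer than
  \<open>x 1\<close>.\<close>

lemma before_first_transmitter:
  assumes b: "b \<in> T" and first: "\<And>i. i \<in> T \<Longrightarrow> b \<le> i"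
  shows "x b \<le> c * end_len (b - 1)"
proof -
  have bJ: "1 \<le> b" "b \<le> J" using b T_subset by auto
  have "x b - x (b - (b - 1)) \<le> 2 * c * sqrt (real (b - 1))"
  proof (rule ladder_bound[of "\<lambda>i. x b - x (b - i)" c "b - 1"])
    fix i assume i: "i < b - 1"
    then have "Suc (b - Suc i) = b - i" by auto
    moreover have "(x b - x (b - Suc i))\<^sup>2 \<le> (x b - x (Suc (b - Suc i)))\<^sup>2 + 4 * c\<^sup>2"
      by (rule step_right) (use first bJ i in \<open>force dest: first\<close>)+
    ultimately show "(x b - x (b - Suc i))\<^sup>2 \<le> (x b - x (b - i))\<^sup>2 + 4 * c\<^sup>2"
      by simp
  qed (use c_nonneg in auto)
  moreover have "b - (b - 1) = 1" using bJ by simp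
  ultimately have v: "x b - x 1 \<le> 2 * c * sqrt (real (b - 1))" by simp
  have pos: "0 \<le> x 1" "x 1 \<le> x b" "0 \<le> x (Suc J)"
    using mono[of 0 1] mono[of 1 b] mono[of 0 "Suc J"] bJ x_0 by auto
  obtain i j where ij: "i \<in> T" "j \<in> {1..J} - T" "\<bar>x i\<bar> * \<bar>x j\<bar> \<le> c\<^sup>2"
    using covered[of 0] pos by auto
  have "x b \<le> x i" "x 1 \<le> x j"
    using first[OF ij(1)] mono[of b i] mono[of 1 j] ij T_subset by auto
  then have "x b * x 1 \<le> \<bar>x i\<bar> * \<bar>x j\<bar>"
    using pos by (intro mult_mono) auto
  with ij have "x b * (x b - (x b - x 1)) \<le> c\<^sup>2" by simp
  with pos show ?thesis by (intro end_bound[OF v]) simp_all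
qed

text \<open>Mirror image of \<open>before_first_transmitter\<close>, using the coverage of the point
  \<open>x (Suc J)\<close>.\<close>

lemma after_last_transmitter:
  assumes a: "a \<in> T" and last: "\<And>i. i \<in> T \<Longrightarrow> i \<le> a"
  shows "x (Suc J) - x a \<le> c * end_len (J - a)"
proof -
  have aJ: "1 \<le> a" "a \<le> J" using a T_subset by auto
  have "x (a + (J - a)) - x a \<le> 2 * c * sqrt (real (J - a))"
  proof (rule ladder_bound[of "\<lambda>i. x (a + i) - x a" c "J - a"])
    fix i assume i: "i < J - a"
    show "(x (a + Suc i) - x a)\<^sup>2 \<le> (x (a + i) - x a)\<^sup>2 + 4 * c\<^sup>2"
      unfolding add_Suc_right
      by (rule step_left) (use last aJ i in \<open>force dest: last\<close>)+
  qed (use c_nonneg in auto)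
  then have v: "x J - x a \<le> 2 * c * sqrt (real (J - a))" using aJ by simp
  have pos: "x J \<le> x (Suc J)" "x a \<le> x J" "0 \<le> x (Suc J)"
    using mono[of J "Suc J"] mono[of a J] mono[of 0 "Suc J"] aJ x_0 by auto
  let ?h = "x (Suc J)"
  obtain i j where ij: "i \<in> T" "j \<in> {1..J} - T" "\<bar>x i - ?h\<bar> * \<bar>x j - ?h\<bar> \<le> c\<^sup>2"
    using covered[of ?h] pos by auto
  have "x i \<le> x a" "x j \<le> x J"
    using last[OF ij(1)] mono[of i a] mono[of j J] ij T_subset aJ by auto
  then have "(?h - x a) * (?h - x J) \<le> \<bar>x i - ?h\<bar> * \<bar>x j - ?h\<bar>"
    using pos by (intro mult_mono) auto
  with ij have "(?h - x a) * ((?h - x a) - (x J - x a)) \<le> c\<^sup>2" by simp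
  with pos show ?thesis by (intro end_bound[OF v]) simp_all
qed

text \<open>A slope \<open>lam\<close> per receiver turns the concave bounds on the pieces into affine ones, so that
  they add up to a bound in \<open>M\<close> and \<open>N\<close> alone. The penalty \<open>L\<close> is incurred as soon as two
  neighbours have the same type.\<close>

lemma length_bound:
  fixes A B lam L :: real
  assumes sec: "\<And>i j n. i + j = n + 1 \<Longrightarrow>
      2 * (sqrt (real i) + sqrt (real j)) \<le> A + lam * real n - (if n = 1 then 0 else L)"
    and ends: "\<And>n. end_len n \<le> B + lam * real n - (if n \<le> 1 then 0 else L)"
    and L: "0 \<le> L" and T_nonempty: "T \<noteq> {}"
  shows "x (Suc J) \<le> c * (2 * B + A * (real (card T) - 1) + lam * real (J - card T)
    - (if \<exists>k\<ge>1. k < J \<and> (k \<in> T \<longleftrightarrow> Suc k \<in> T) then L else 0))"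
proof -
  define same where "same k \<longleftrightarrow> (k \<in> T \<longleftrightarrow> Suc k \<in> T)" for k
  define bad where "bad b \<longleftrightarrow> (\<exists>k\<ge>1. k < b \<and> same k)" for b
  define t where "t b = card {i \<in> T. i < b}" for b
  have finT: "finite T" using T_subset finite_subset by blast
  \<comment> \<open>Of the \<open>b - 1\<close> entries before \<open>b\<close>, \<open>t b\<close>
    are transmitters and the rest receivers: \<open>B\<close> pays for the left end,
    \<open>A\<close> for each section, \<open>lam\<close> for each receiver.\<close>
  have upto: "x b \<le> c * (B + (A - lam) * real (t b) + lam * (real b - 1)
      - (if bad b then L else 0))" if "b \<in> T" for b
    using that
  proof (induction b rule: less_induct)
    case (less b)
    have b1: "1 \<le> b" "b \<le> J" using less.prems T_subset by auto
    show ?case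
    proof (cases "\<exists>i\<in>T. i < b")
      case False
      then have first: "\<And>i. i \<in> T \<Longrightarrow> b \<le> i" by force
      have "t b = 0" using False by (auto simp: t_def)
      have "x b \<le> c * end_len (b - 1)"
        using before_first_transmitter less.prems first by blast
      also have "\<dots> \<le> c * (B + lam * real (b - 1) - (if b - 1 \<le> 1 then 0 else L))"
        using ends c_nonneg by (intro mult_left_mono) auto
      also have "\<dots> \<le> c * (B + lam * (real b - 1) - (if bad b then L else 0))"
      proof -
        \<comment> \<open>Equal neighbours up to the first transmitter are two receivers, so at
          least two receivers precede it and the penalty of the left end applies.\<close>
        have "\<not> b - 1 \<le> 1" if bad: "bad b"
        proof
          assume "b - 1 \<le> 1"
          obtain k where "1 \<le> k" "k < b" "same k"
            using bad unfolding bad_def by blast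
          moreover from this \<open>b - 1 \<le> 1\<close> have "b = Suc k" by auto
          moreover have "k \<notin> T" using first[of k] \<open>k < b\<close> by auto
          ultimately show False using less.prems by (simp add: same_def)
        qed
        then show ?thesis
          using b1 L c_nonneg by (intro mult_left_mono) (auto simp: of_nat_diff)
      qed
      finally show ?thesis using \<open>t b = 0\<close> by simp
    next
      case True
      define a where "a = Max {i \<in> T. i < b}"
      have fin: "finite {i \<in> T. i < b}" and ne: "{i \<in> T. i < b} \<noteq> {}"
        using True finT by auto
      have a: "a \<in> T" "a < b" using Max_in[OF fin ne] by (auto simp: a_def)
      have between: "\<And>i. i \<in> T \<Longrightarrow> i \<le> a \<or> b \<le> i"
        using Max_ge[OF fin] by (force simp: a_def)
      obtain i j where ij: "i + j = b - a" "x b - x a \<le> 2 * c * (sqrt i + sqrt j)"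
        using between_transmitters[OF a(1) less.prems a(2) between] by blast
      define n where "n = b - a - 1"
      have n: "b = a + n + 1" using a by (simp add: n_def)
      have "{i \<in> T. i < b} = insert a {i \<in> T. i < a}"
        using a between by force
      then have tb: "t b = t a + 1" using finT by (simp add: t_def)
      have "x b - x a \<le> c * (2 * (sqrt i + sqrt j))" using ij(2) by (simp only: mult.assoc mult.left_commute)
      also have "\<dots> \<le> c * (A + lam * real n - (if n = 1 then 0 else L))"
        using sec[of i j n] ij n c_nonneg by (intro mult_left_mono) auto
      finally have "x b \<le> x a + c * (A + lam * real n - (if n = 1 then 0 else L))"
        by simp
      also have "\<dots> \<le> c * (B + (A - lam) * real (t a) + lam * (real a - 1)
          - (if bad a then L else 0)) + c * (A + lam * real n - (if n = 1 then 0 else L))"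
        using less.IH[OF a(2) a(1)] by simp
      also have "\<dots> = c * (B + (A - lam) * real (t b) + lam * (real b - 1)
          - ((if bad a then L else 0) + (if n = 1 then 0 else L)))"
        using n tb by (simp add: algebra_simps)
      also have "\<dots> \<le> c * (B + (A - lam) * real (t b) + lam * (real b - 1)
          - (if bad b then L else 0))"
      proof -
        \<comment> \<open>A section with exactly one receiver adds no equal neighbours, so they
          occur up to \<open>a\<close> and are already penalized there. If both penalties are due,
          one is dropped.\<close>
        have "bad a" if bad: "bad b" and "n = 1"
        proof -
          obtain k where k: "1 \<le> k" "k < b" "same k"
            using bad unfolding bad_def by blast
          have "Suc a \<notin> T" using between[of "Suc a"] n \<open>n = 1\<close> by auto
          then have "k \<noteq> a" "k \<noteq> Suc a" using k a n \<open>n = 1\<close> less.prems by (auto simp: same_def)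
          then show "bad a" using k n \<open>n = 1\<close> by (auto simp: bad_def)
        qed
        then show ?thesis using L c_nonneg by (intro mult_left_mono) auto
      qed
      finally show ?thesis .
    qed
  qed
  define b where "b = Max T"
  have b: "b \<in> T" using Max_in[OF finT T_nonempty] by (simp add: b_def)
  have last: "\<And>i. i \<in> T \<Longrightarrow> i \<le> b" using Max_ge[OF finT] by (simp add: b_def)
  have bJ: "1 \<le> b" "b \<le> J" using b T_subset by auto
  have "T = insert b {i \<in> T. i < b}" using b last by force
  then have "card T = Suc (t b)"
    using finT unfolding t_def by (metis (lifting) card_insert_disjoint finite_insert mem_Collect_eq nless_le)
  moreover have "card T \<le> J" using card_mono[OF _ T_subset] by simp
  ultimately have tb: "real (t b) = real (card T) - 1"
    "real (J - card T) = real J - real (t b) - 1" by auto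
  have "x (Suc J) \<le> x b + c * end_len (J - b)"
    using after_last_transmitter[OF b last] by simp
  also have "\<dots> \<le> c * (B + (A - lam) * real (t b) + lam * (real b - 1) - (if bad b then L else 0))
      + c * (B + lam * real (J - b) - (if J - b \<le> 1 then 0 else L))"
    using upto[OF b] ends c_nonneg by (intro add_mono mult_left_mono) auto
  also have "\<dots> = c * (2 * B + A * (real (card T) - 1) + lam * real (J - card T)
      - ((if bad b then L else 0) + (if J - b \<le> 1 then 0 else L)))"
    using bJ unfolding tb by (simp add: algebra_simps of_nat_diff tb)
  also have "\<dots> \<le> c * (2 * B + A * (real (card T) - 1) + lam * real (J - card T)
      - (if bad J then L else 0))"
  proof -
    \<comment> \<open>At most one receiver after the last transmitter adds no equal
      neighbours.\<close>
    have "bad b" if J: "bad J" "J - b \<le> 1"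
    proof -
      obtain k where k: "1 \<le> k" "k < J" "same k"
        using J unfolding bad_def by blast
      then have "k \<noteq> b" using last[of "Suc k"] b by (auto simp: same_def)
      then show "bad b" using k J by (auto simp: bad_def)
    qed
    then show ?thesis using L c_nonneg by (intro mult_left_mono) auto
  qed
  finally show ?thesis unfolding bad_def same_def .
qed

text \<open>The length is the sum of the mean length of the chains from 1 to \<open>J - 1\<close>
  and from 2 to \<open>J\<close> and, at each end, the mean distance of the two nearest entries.
  Each chain has \<open>J - 2\<close> gaps of at most \<open>2 * c\<close>. The pair covering an end
  node consists of two different entries, so the product of the two smallest distances is already at
  most \<open>c\<^sup>2\<close>.\<close>

lemma alternating_bound:
  assumes J: "2 \<le> J" and alt: "\<And>k. 1 \<le> k \<Longrightarrow> k < J \<Longrightarrow> k \<in> T \<longleftrightarrow> Suc k \<notin> T"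
  shows "x (Suc J) \<le> c * (2 * real J - 4 + 2 * sqrt 2)"
proof -
  let ?h = "x (Suc J)"
  have run: "x (k + n) - x k \<le> 2 * c * real n" if "k + n \<le> Suc J" for k n
    using that
  proof (induction n)
    case (Suc n)
    then show ?case using gap_le[of "k + n"] by (simp add: algebra_simps)
  qed simp
  \<comment> \<open>The square of the mean is \<open>u * v + ((v - u) / 2)\<^sup>2\<close>, and both
    summands are at most \<open>c\<^sup>2\<close>.\<close>
  have half: "(u + v) / 2 \<le> c * sqrt 2" if "u * v \<le> c\<^sup>2" "\<bar>v - u\<bar> \<le> 2 * c" for u v
  proof -
    have "(v - u)\<^sup>2 \<le> (2 * c)\<^sup>2" using that c_nonneg by (intro abs_le_square_iff[THEN iffD1]) auto
    moreover have "((u + v) / 2)\<^sup>2 = u * v + (v - u)\<^sup>2 / 4"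
      by (simp add: field_simps power2_eq_square)
    ultimately have "((u + v) / 2)\<^sup>2 \<le> (c * sqrt 2)\<^sup>2"
      using that(1) by (simp add: power_mult_distrib)
    then have "(u + v) / 2 \<le> c * sqrt 2"
      by (rule power2_le_imp_le) (use c_nonneg in auto)
    then show ?thesis .
  qed
  have pos: "0 \<le> x 1" "x 1 \<le> x 2" "x (J - 1) \<le> x J" "x J \<le> ?h" "0 \<le> ?h"
    using mono[of 0 1] mono[of 1 2] mono[of "J - 1" J] mono[of J "Suc J"] mono[of 0 "Suc J"] J x_0
    by auto
  have "x 1 * x 2 \<le> c\<^sup>2"
  proof -
    obtain i j where ij: "i \<in> T" "j \<in> {1..J} - T" "\<bar>x i\<bar> * \<bar>x j\<bar> \<le> c\<^sup>2"
      using covered[of 0] pos by auto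
    have r: "i \<in> {1..J}" "j \<in> {1..J}" using ij T_subset by auto
    have "1 \<in> T \<longleftrightarrow> 2 \<notin> T" using alt[of 1] J by (simp add: numeral_2_eq_2)
    moreover have "i \<noteq> j" using ij by auto
    ultimately have "2 \<le> i \<or> 2 \<le> j" using r by force
    then have "x 1 * x 2 \<le> \<bar>x i\<bar> * \<bar>x j\<bar>"
    proof
      assume "2 \<le> i"
      then have "x 2 \<le> x i" "x 1 \<le> x j" using mono r by auto
      then have "x 2 * x 1 \<le> \<bar>x i\<bar> * \<bar>x j\<bar>" using pos by (intro mult_mono) auto
      then show ?thesis by (simp add: mult.commute)
    next
      assume "2 \<le> j"
      then have "x 2 \<le> x j" "x 1 \<le> x i" using mono r by auto
      then show ?thesis using pos by (intro mult_mono) auto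
    qed
    with ij show ?thesis by simp
  qed
  moreover have "\<bar>x 2 - x 1\<bar> \<le> 2 * c" using gap_le[of 1] J pos by (simp add: numeral_2_eq_2)
  ultimately have first: "(x 1 + x 2) / 2 \<le> c * sqrt 2" by (rule half)
  have "(?h - x J) * (?h - x (J - 1)) \<le> c\<^sup>2"
  proof -
    obtain i j where ij: "i \<in> T" "j \<in> {1..J} - T" "\<bar>x i - ?h\<bar> * \<bar>x j - ?h\<bar> \<le> c\<^sup>2"
      using covered[of ?h] pos by auto
    have r: "i \<in> {1..J}" "j \<in> {1..J}" using ij T_subset by auto
    have "i \<noteq> j" using ij by auto
    then have "i \<le> J - 1 \<or> j \<le> J - 1" using r by force
    then have "(?h - x J) * (?h - x (J - 1)) \<le> \<bar>x i - ?h\<bar> * \<bar>x j - ?h\<bar>"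
    proof
      assume "i \<le> J - 1"
      then have "x i \<le> x (J - 1)" "x j \<le> x J" using mono r by auto
      then have "(?h - x (J - 1)) * (?h - x J) \<le> \<bar>x i - ?h\<bar> * \<bar>x j - ?h\<bar>"
        using pos by (intro mult_mono) auto
      then show ?thesis by (simp add: mult.commute)
    next
      assume "j \<le> J - 1"
      then have "x j \<le> x (J - 1)" "x i \<le> x J" using mono r by auto
      then show ?thesis using pos by (intro mult_mono) auto
    qed
    with ij show ?thesis by simp
  qed
  moreover have "\<bar>(?h - x (J - 1)) - (?h - x J)\<bar> \<le> 2 * c" using gap_le[of "J - 1"] J pos by simp
  ultimately have final: "((?h - x J) + (?h - x (J - 1))) / 2 \<le> c * sqrt 2"
    by (rule half)
  have "1 + (J - 2) = J - 1" "2 + (J - 2) = J" using J by auto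
  then have "x (J - 1) - x 1 \<le> 2 * c * real (J - 2)" "x J - x 2 \<le> 2 * c * real (J - 2)"
    using run[of 1 "J - 2"] run[of 2 "J - 2"] by simp_all
  with first final have "?h \<le> 2 * (c * sqrt 2) + 2 * c * real (J - 2)"
    by (simp add: field_simps)
  then show ?thesis using J by (simp add: algebra_simps of_nat_diff)
qed

end

subsection \<open>Deployments attaining the bounds\<close>

text \<open>An existential form of \<open>I_val S D p \<le> c\<^sup>2\<close> that also makes sense
  for fragments of an order and survives the addition of further nodes.\<close>

definition covered_at :: "real \<Rightarrow> node list \<Rightarrow> real list \<Rightarrow> real \<Rightarrow> bool" where
  "covered_at c S D p \<longleftrightarrow> (\<exists>i<length S. \<exists>j<length S. is_Trans (S ! i) \<and> is_Recv (S ! j) \<and>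
     \<bar>loc D i - p\<bar> * \<bar>loc D j - p\<bar> \<le> c\<^sup>2)"

lemma covered_atI:
  assumes "i < length S" "j < length S" "is_Trans (S ! i)" "is_Recv (S ! j)"
    "\<bar>loc D i - p\<bar> * \<bar>loc D j - p\<bar> \<le> c\<^sup>2"
  shows "covered_at c S D p"
  using assms unfolding covered_at_def by blast

text \<open>A fragment lists the nodes at both of its ends, hence one node more than gaps, and
  starts at coordinate 0.\<close>

definition covers :: "real \<Rightarrow> node list \<Rightarrow> real list \<Rightarrow> bool" where
  "covers c S D \<longleftrightarrow> length S = length D + 1 \<and> (\<forall>p\<in>{0..sum_list D}. covered_at c S D p)"

section \<open>Gluing and reflecting fragments\<close>

lemma loc_append: "loc (D0 @ D1) (length D0 + k) = sum_list D0 + loc D1 k"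
  by (simp add: loc_def)

lemma loc_append_le: "k \<le> length D0 \<Longrightarrow> loc (D0 @ D1) k = loc D0 k"
  by (simp add: loc_def)

lemma loc_rev:
  assumes "k \<le> length D"
  shows "loc (rev D) (length D - k) = sum_list D - loc D k"
proof -
  have "sum_list D = sum_list (take k D) + sum_list (drop k D)"
    by (metis append_take_drop_id sum_list_append)
  then show ?thesis using assms by (simp add: loc_def take_rev sum_list_rev)
qed

lemma covered_at_append_left:
  assumes "length S0 = length D0" "covered_at c S D (p - sum_list D0)"
  shows "covered_at c (S0 @ S) (D0 @ D) p"
proof -
  obtain i j where "i < length S" "j < length S" "is_Trans (S ! i)" "is_Recv (S ! j)"
    "\<bar>loc D i - (p - sum_list D0)\<bar> * \<bar>loc D j - (p - sum_list D0)\<bar> \<le> c\<^sup>2"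
    using assms(2) by (auto simp: covered_at_def)
  moreover have "loc (D0 @ D) (length D0 + k) - p = loc D k - (p - sum_list D0)" for k
    by (simp add: loc_append)
  moreover have "(S0 @ S) ! (length D0 + k) = S ! k" for k
    using assms(1) by (metis nth_append_length_plus)
  ultimately show ?thesis
    using assms(1) by (intro covered_atI[of "length D0 + i" _ "length D0 + j"]) (simp_all add: diff_diff_eq2)
qed

lemma covered_at_append_right:
  assumes "length S \<le> length D + 1" "covered_at c S D p"
  shows "covered_at c (S @ S1) (D @ D1) p"
proof -
  obtain i j where "i < length S" "j < length S" "is_Trans (S ! i)" "is_Recv (S ! j)"
    "\<bar>loc D i - p\<bar> * \<bar>loc D j - p\<bar> \<le> c\<^sup>2"
    using assms(2) by (auto simp: covered_at_def)
  then show ?thesis using assms(1)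
    by (intro covered_atI[of i _ j]) (auto simp: nth_append loc_append_le)
qed

lemma covered_at_rev:
  assumes "length S = length D + 1" "covered_at c S D (sum_list D - p)"
  shows "covered_at c (rev S) (rev D) p"
proof -
  obtain i j where ij: "i < length S" "j < length S" "is_Trans (S ! i)" "is_Recv (S ! j)"
    "\<bar>loc D i - (sum_list D - p)\<bar> * \<bar>loc D j - (sum_list D - p)\<bar> \<le> c\<^sup>2"
    using assms(2) by (auto simp: covered_at_def)
  have "\<bar>loc (rev D) (length D - k) - p\<bar> = \<bar>loc D k - (sum_list D - p)\<bar>" if "k < length S" for k
    using that assms(1) by (simp add: loc_rev)
  moreover have "rev S ! (length D - k) = S ! k" if "k < length S" for k
    using that assms(1) by (simp add: rev_nth)
  moreover have "length D - k < length (rev S)" for k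
    using assms(1) by simp
  ultimately show ?thesis using ij
    by (intro covered_atI[of "length D - i" _ "length D - j"]) (simp_all add: diff_diff_eq2)
qed

lemma covers_rev: "covers c S D \<Longrightarrow> covers c (rev S) (rev D)"
  by (auto simp: covers_def sum_list_rev intro: covered_at_rev)

text \<open>The fragments share the node \<open>y\<close>, which stands at
  \<open>sum_list D0\<close>: points up to it are covered by the first fragment, later ones by the
  second.\<close>

lemma covers_append:
  assumes "covers c (xs @ [y]) D0" "covers c (y # ys) D1"
  shows "covers c (xs @ y # ys) (D0 @ D1)"
proof -
  have "covered_at c (xs @ y # ys) (D0 @ D1) p" if p: "p \<in> {0..sum_list (D0 @ D1)}" for p
  proof (cases "p \<le> sum_list D0")
    case True
    then have "covered_at c ((xs @ [y]) @ ys) (D0 @ D1) p"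
      using p assms(1) unfolding covers_def by (intro covered_at_append_right) auto
    then show ?thesis by simp
  next
    case False
    then show ?thesis
      using p assms unfolding covers_def by (intro covered_at_append_left) auto
  qed
  then show ?thesis using assms by (auto simp: covers_def)
qed

section \<open>Ladders, ends and sections\<close>

text \<open>These gaps give equality in every step of \<open>ladder_bound\<close>; they telescope,
  which puts rung \<open>k\<close> at \<open>2 * c * sqrt k\<close>.\<close>

definition ladder :: "real \<Rightarrow> nat \<Rightarrow> real list" where
  "ladder c n = map (\<lambda>k. 2 * c * (sqrt (k + 1) - sqrt k)) [0..<n]"

lemma length_ladder [simp]: "length (ladder c n) = n"
  by (simp add: ladder_def)

lemma sum_ladder [simp]: "sum_list (ladder c n) = 2 * c * sqrt n"
  by (induction n) (auto simp: ladder_def algebra_simps)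

lemma loc_ladder: "k \<le> n \<Longrightarrow> loc (ladder c n) k = 2 * c * sqrt k"
proof -
  assume "k \<le> n"
  then have "take k (ladder c n) = ladder c k" by (simp add: ladder_def take_map)
  then show ?thesis by (simp add: loc_def)
qed

lemma ladder_nonneg: "0 \<le> c \<Longrightarrow> d \<in> set (ladder c n) \<Longrightarrow> 0 \<le> d"
  by (auto simp: ladder_def)

text \<open>The transmitter stands at 0 and \<open>a\<close>, \<open>b\<close> are consecutive
  rungs. At their midpoint both products equal \<open>c\<^sup>2\<close>; before it the lower rung
  suffices, after it the upper one.\<close>

lemma rung_covered:
  fixes a b c p :: real
  assumes "b\<^sup>2 = a\<^sup>2 + 4 * c\<^sup>2" "0 \<le> a" "a \<le> p" "p \<le> b"
  shows "p * (p - a) \<le> c\<^sup>2 \<or> p * (b - p) \<le> c\<^sup>2"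
proof -
  define m where "m = (a + b) / 2"
  have m: "m * (m - a) = c\<^sup>2" "m * (b - m) = c\<^sup>2"
    using assms(1) by (auto simp: m_def field_simps power2_eq_square)
  show ?thesis
  proof (cases "p \<le> m")
    case True
    then have "p * (p - a) \<le> m * (m - a)" using assms by (intro mult_mono) auto
    then show ?thesis using m by simp
  next
    case False
    \<comment> \<open>Since \<open>a\<close> is nonnegative, \<open>m\<close> is at least
      \<open>b / 2\<close>, and \<open>p * (b - p)\<close> decreases from there on.\<close>
    moreover from False have "b \<le> p + m" using assms(2) by (simp add: m_def field_simps)
    ultimately have "0 \<le> (p - m) * (p + m - b)" by simp
    also have "\<dots> = m * (b - m) - p * (b - p)" by (simp add: algebra_simps)
    finally show ?thesis using m by simp
  qed
qed

lemma covers_ladder: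
  assumes "0 \<le> c" "length rs = n" "1 \<le> n"
  shows "covers c (Trans t # map Recv rs) (ladder c n)"
proof -
  let ?S = "Trans t # map Recv rs"
  have "covered_at c ?S (ladder c n) p" if p: "0 \<le> p" "p \<le> 2 * c * sqrt n" for p
  proof -
    \<comment> \<open>The rungs around \<open>p\<close> are \<open>k\<close> and
      \<open>Suc k\<close>, where rung 0 is the transmitter.\<close>
    define k where "k = (LEAST k. p \<le> 2 * c * sqrt (Suc k))"
    have ex: "p \<le> 2 * c * sqrt (Suc (n - 1))" using p assms by simp
    have upper: "p \<le> 2 * c * sqrt (Suc k)" unfolding k_def by (rule LeastI[of _ "n - 1"]) (rule ex)
    have "k \<le> n - 1" unfolding k_def by (rule Least_le) (rule ex)
    then have kn: "k < n" using assms by simp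
    have lower: "2 * c * sqrt k \<le> p"
    proof (cases k)
      case (Suc l)
      then have "\<not> p \<le> 2 * c * sqrt (Suc l)" unfolding k_def by (metis lessI not_less_Least)
      then show ?thesis using Suc by simp
    qed (use p in simp)
    have sq: "(2 * c * sqrt (Suc k))\<^sup>2 = (2 * c * sqrt k)\<^sup>2 + 4 * c\<^sup>2"
      by (simp add: power_mult_distrib algebra_simps)
    have recv: "covered_at c ?S (ladder c n) p"
      if "1 \<le> j" "j \<le> n" "p * \<bar>2 * c * sqrt j - p\<bar> \<le> c\<^sup>2" for j
      using that p assms
      by (intro covered_atI[of 0 _ j]) (auto simp: loc_ladder nth_Cons')
    consider "p * (p - 2 * c * sqrt k) \<le> c\<^sup>2" | "p * (2 * c * sqrt (Suc k) - p) \<le> c\<^sup>2"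
      using rung_covered[OF sq _ lower upper] assms(1) by auto
    then show ?thesis
    proof cases
      case 1
      show ?thesis
      proof (cases "k = 0")
        case True
        \<comment> \<open>Rung 0 holds no receiver, but the one at \<open>2 * c\<close> covers the
          whole first gap, as \<open>p * (2 * c - p)\<close> peaks at
          \<open>c\<^sup>2\<close>.\<close>
        have "0 \<le> (p - c)\<^sup>2" by simp
        then have "p * (2 * c - p) \<le> c\<^sup>2" by (simp add: power2_eq_square algebra_simps)
        then show ?thesis using recv[of 1] True upper assms by simp
      next
        case False
        then show ?thesis using recv[of k] 1 lower kn by (simp add: abs_minus_commute)
      qed
    next
      case 2
      then show ?thesis using recv[of "Suc k"] upper kn by simp
    qed
  qed
  then show ?thesis using assms by (auto simp: covers_def)
qed

text \<open>What \<open>c * end_len n\<close> leaves beyond the last rung at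
  \<open>2 * c * sqrt n\<close>.\<close>

definition end_gap :: "real \<Rightarrow> nat \<Rightarrow> real" where
  "end_gap c n = c * (sqrt (n + 1) - sqrt n)"

text \<open>Beyond the last rung, the product for the transmitter and the last receiver increases up
  to the end, where it is \<open>c\<^sup>2\<close> because
  \<open>(sqrt (n + 1) + sqrt n) * (sqrt (n + 1) - sqrt n) = 1\<close>.\<close>

lemma covers_end:
  assumes "0 \<le> c" "length rs = n" "1 \<le> n"
  shows "covers c (Trans t # map Recv rs @ [y]) (ladder c n @ [end_gap c n])"
proof -
  let ?S = "Trans t # map Recv rs @ [y]" and ?D = "ladder c n @ [end_gap c n]"
  have "covered_at c ?S ?D p" if p: "0 \<le> p" "p \<le> sum_list ?D" for p
  proof (cases "p \<le> 2 * c * sqrt n")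
    case True
    then have "covered_at c ((Trans t # map Recv rs) @ [y]) ?D p"
      using covers_ladder[OF assms, of t] p(1) assms(2) unfolding covers_def
      by (intro covered_at_append_right) auto
    then show ?thesis by simp
  next
    case False
    have "p \<le> c * (sqrt (n + 1) + sqrt n)"
      using p(2) by (simp add: end_gap_def algebra_simps)
    moreover have "p - 2 * c * sqrt n \<le> c * (sqrt (n + 1) - sqrt n)"
      using p(2) by (simp add: end_gap_def)
    ultimately have "p * (p - 2 * c * sqrt n)
        \<le> (c * (sqrt (n + 1) + sqrt n)) * (c * (sqrt (n + 1) - sqrt n))"
      using False assms(1) by (intro mult_mono) auto
    also have "\<dots> = c\<^sup>2 * ((sqrt (n + 1))\<^sup>2 - (sqrt n)\<^sup>2)"
      by (simp only: power2_eq_square) algebra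
    also have "\<dots> = c\<^sup>2" by simp
    finally show ?thesis
      using assms False p(1)
      by (intro covered_atI[of 0 _ n]) (auto simp: loc_append_le loc_ladder nth_append nth_Cons')
  qed
  then show ?thesis using assms by (auto simp: covers_def)
qed

text \<open>The \<open>n + 1\<close> gaps are split as evenly as possible between two facing
  ladders, which makes \<open>sqrt i + sqrt j\<close> largest for
  \<open>i + j = n + 1\<close>.\<close>

definition section_gaps :: "real \<Rightarrow> nat \<Rightarrow> real list" where
  "section_gaps c n = ladder c ((n + 2) div 2) @ rev (ladder c ((n + 1) div 2))"

definition section_len :: "nat \<Rightarrow> real" where
  "section_len n = 2 * (sqrt ((n + 2) div 2) + sqrt ((n + 1) div 2))"

lemma length_section_gaps [simp]: "length (section_gaps c n) = n + 1"
  by (simp add: section_gaps_def)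

lemma sum_section_gaps [simp]: "sum_list (section_gaps c n) = c * section_len n"
  by (simp add: section_gaps_def section_len_def sum_list_rev algebra_simps)

text \<open>The two ladders share their top rung: since \<open>i + j = n + 1\<close>, the
  \<open>i\<close>-th receiver from the left is the \<open>j\<close>-th from the right.\<close>

lemma covers_section:
  assumes "0 \<le> c" "length rs = n" "1 \<le> n"
  shows "covers c (Trans t # map Recv rs @ [Trans t']) (section_gaps c n)"
proof -
  define i j where "i = (n + 2) div 2" and "j = (n + 1) div 2"
  have ij: "i + j = n + 1" "1 \<le> i" "1 \<le> j" "i \<le> n" "j \<le> n"
    using assms by (auto simp: i_def j_def)
  let ?S = "Trans t # map Recv rs @ [Trans t']" and ?D = "ladder c i @ rev (ladder c j)"
  have split: "map Recv rs @ [Trans t'] = map Recv (take k rs) @ map Recv (drop k rs) @ [Trans t']" for k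
    by (metis append_assoc append_take_drop_id map_append)
  have front: "covers c (Trans t # map Recv (take i rs)) (ladder c i)"
    using assms ij by (intro covers_ladder) auto
  have "covers c (Trans t' # map Recv (rev (drop (n - j) rs))) (ladder c j)"
    using assms ij by (intro covers_ladder) auto
  from covers_rev[OF this] have rear: "covers c (map Recv (drop (n - j) rs) @ [Trans t']) (rev (ladder c j))"
    by (simp add: rev_map)
  have "covered_at c ?S ?D p" if p: "0 \<le> p" "p \<le> sum_list ?D" for p
  proof (cases "p \<le> sum_list (ladder c i)")
    case True
    have "covered_at c ((Trans t # map Recv (take i rs)) @ map Recv (drop i rs) @ [Trans t']) ?D p"
      using front True p(1) assms(2) ij(4) unfolding covers_def
      by (intro covered_at_append_right) auto
    then show ?thesis by (simp only: split[of i] append_Cons)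
  next
    case False
    have "covered_at c ((Trans t # map Recv (take (n - j) rs)) @
        map Recv (drop (n - j) rs) @ [Trans t']) ?D p"
      using rear False p(2) assms(2) ij unfolding covers_def
      by (intro covered_at_append_left) auto
    then show ?thesis by (simp only: split[of "n - j"] append_Cons)
  qed
  then show ?thesis
    using assms by (auto simp: covers_def section_gaps_def i_def j_def)
qed

section \<open>Orders with prescribed receiver counts\<close>

text \<open>The next transmitter and receiver have the numbers \<open>i\<close> and
  \<open>j\<close>; \<open>ms\<close> lists the counts between transmitters, and \<open>n\<close> is
  the count after the last one.\<close>

primrec arrangement :: "nat \<Rightarrow> nat \<Rightarrow> nat list \<Rightarrow> nat \<Rightarrow> node list" where
  "arrangement i j [] n = Trans i # map Recv [j..<j + n]"
| "arrangement i j (m # ms) n =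
     Trans i # map Recv [j..<j + m] @ arrangement (Suc i) (j + m) ms n"

lemma set_arrangement:
  "set (arrangement i j ms n) =
     Trans ` {i..i + length ms} \<union> Recv ` {j..<j + sum_list ms + n}"
proof (induction ms arbitrary: i j)
  case (Cons m ms)
  have "{i..i + length (m # ms)} = insert i {Suc i..Suc i + length ms}" by auto
  moreover have "{j..<j + sum_list (m # ms) + n} = {j..<j + m} \<union> {j + m..<j + m + sum_list ms + n}"
    by auto
  ultimately show ?case using Cons by (simp add: image_Un Un_ac)
qed auto

lemma distinct_arrangement: "distinct (arrangement i j ms n)"
  by (induction ms arbitrary: i j) (auto simp: set_arrangement distinct_map inj_on_def)

definition deployed :: "nat \<Rightarrow> nat list \<Rightarrow> nat \<Rightarrow> node list" where
  "deployed n0 ms n = Hl # (map Recv [0..<n0] @ arrangement 0 n0 ms n) @ [Hr]"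

lemma deployed_in_orders: "deployed n0 ms n \<in> orders (length ms + 1) (n0 + sum_list ms + n)"
proof -
  have "{0..<n0} \<union> {n0..<n0 + sum_list ms + n} = {..<n0 + sum_list ms + n}" by auto
  then have recvs: "Recv ` {0..<n0} \<union> Recv ` {n0..<n0 + sum_list ms + n}
      = Recv ` {..<n0 + sum_list ms + n}"
    by (metis image_Un)
  have "set (map Recv [0..<n0] @ arrangement 0 n0 ms n)
      = nodes (length ms + 1) (n0 + sum_list ms + n)"
    unfolding nodes_def set_append set_map set_upt set_arrangement
      Un_left_commute[of "Recv ` {0..<n0}"] recvs
    by (simp add: atLeast0AtMost lessThan_Suc_atMost)
  moreover have "distinct (map Recv [0..<n0] @ arrangement 0 n0 ms n)"
    by (auto simp: distinct_arrangement set_arrangement distinct_map inj_on_def)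
  ultimately show ?thesis
    unfolding deployed_def orders_def permutations_of_set_def by blast
qed

abbreviation is_fence :: "node \<Rightarrow> bool" where
  "is_fence v \<equiv> is_Hl v \<or> is_Trans v \<or> is_Hr v"

lemma fences_Cons_block:
  assumes "is_fence x"
  shows "fences (x # map Recv rs @ ys) = 0 # map ((+) (length rs + 1)) (fences ys)"
proof -
  let ?S = "x # map Recv rs @ ys" and ?L = "length rs + 1"
  have upt: "[0..<length ?S] = 0 # [1..<?L] @ map ((+) ?L) [0..<length ys]"
  proof -
    have "(+) ?L = (\<lambda>k. k + ?L)" by auto
    then have "map ((+) ?L) [0..<length ys] = [?L..<length ys + ?L]"
      by (simp only: map_add_upt)
    moreover have "[0..<?L + length ys] = [0..<?L] @ [?L..<?L + length ys]"
      by (rule upt_add_eq_append) simp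
    moreover have "[0..<?L] = 0 # [1..<?L]" by (simp add: upt_conv_Cons del: upt_Suc)
    moreover have "length ?S = ?L + length ys" by simp
    ultimately show ?thesis by (simp only: append_Cons add.commute)
  qed
  have "filter (\<lambda>k. is_fence (?S ! k)) [1..<?L] = []"
    by (auto simp: filter_empty_conv nth_Cons' nth_append)
  moreover have "filter (\<lambda>k. is_fence (?S ! k)) (map ((+) ?L) [0..<length ys])
      = map ((+) ?L) (fences ys)"
    unfolding fences_def filter_map by (rule arg_cong[where f = "map _"], rule filter_cong) (auto simp: nth_append)
  ultimately show ?thesis
    using assms unfolding fences_def upt filter_append filter.simps by simp
qed

text \<open>Turns counting by list places into a recursion over blocks. The first two fences stand
  at places 0 and \<open>length rs + 1\<close>; the places of the remaining list are all shifted by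
  \<open>length rs + 1\<close>, which leaves its counts unchanged.\<close>

lemma receiver_counts_Cons_block:
  assumes "is_fence x" "is_fence y"
  shows "receiver_counts (x # map Recv rs @ y # ys) = length rs # receiver_counts (y # ys)"
proof -
  let ?V = "y # ys" and ?L = "length rs + 1"
  let ?S = "x # map Recv rs @ ?V"
  have F: "fences ?S = 0 # map ((+) ?L) (fences ?V)"
    using fences_Cons_block assms by blast
  obtain fs where V: "fences ?V = 0 # fs"
    using fences_Cons_block[OF assms(2), of "[]" ys] by auto
  have head: "card {k. 0 < k \<and> k < ?L \<and> is_Recv (?S ! k)} = length rs"
  proof -
    have "{k. 0 < k \<and> k < ?L \<and> is_Recv (?S ! k)} = {1..<?L}"
      by (auto simp: nth_Cons' nth_append)
    then show ?thesis by simp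
  qed
  have tail: "card {k. ?L + a < k \<and> k < ?L + b \<and> is_Recv (?S ! k)}
      = card {k. a < k \<and> k < b \<and> is_Recv (?V ! k)}" for a b
  proof -
    have "{k. ?L + a < k \<and> k < ?L + b \<and> is_Recv (?S ! k)}
        = (+) ?L ` {k. a < k \<and> k < b \<and> is_Recv (?V ! k)}" (is "?A = ?B")
    proof
      show "?A \<subseteq> ?B"
      proof
        fix k assume k: "k \<in> ?A"
        then have "k = ?L + (k - ?L)" by simp
        moreover have "k - ?L \<in> {k. a < k \<and> k < b \<and> is_Recv (?V ! k)}"
          using k by (auto simp: nth_append nth_Cons' split: if_splits)
        ultimately show "k \<in> ?B" by blast
      qed
      show "?B \<subseteq> ?A" by (auto simp: nth_append)
    qed
    then show ?thesis by (simp only: card_image[OF inj_on_add])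
  qed
  let ?count = "\<lambda>i. card {k. fences ?S ! i < k \<and> k < fences ?S ! (i + 1) \<and> is_Recv (?S ! k)}"
  have nth: "fences ?S ! Suc i = ?L + fences ?V ! i" if "i < length (fences ?V)" for i
    using that unfolding F by simp
  have "fences ?S ! 0 = 0" unfolding F by simp
  moreover have "fences ?S ! (0 + 1) = ?L" using nth[of 0] V by simp
  ultimately have first: "?count 0 = length rs" using head by simp
  have rest: "map ?count (map Suc [0..<length (fences ?V) - 1]) = receiver_counts ?V"
    unfolding receiver_counts_def map_map
  proof (rule map_cong)
    fix i assume "i \<in> set [0..<length (fences ?V) - 1]"
    then have "fences ?S ! Suc i = ?L + fences ?V ! i"
      "fences ?S ! (Suc i + 1) = ?L + fences ?V ! (i + 1)"
      using nth[of i] nth[of "Suc i"] by auto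
    then show "(?count \<circ> Suc) i
        = card {k. fences ?V ! i < k \<and> k < fences ?V ! (i + 1) \<and> is_Recv (?V ! k)}"
      unfolding comp_def by (simp only: tail)
  qed simp
  have "[0..<length (fences ?S) - 1] = 0 # map Suc [0..<length (fences ?V) - 1]"
    unfolding F V by (simp add: map_Suc_upt upt_conv_Cons del: upt_Suc)
  then have "receiver_counts ?S = ?count 0 # map ?count (map Suc [0..<length (fences ?V) - 1])"
    unfolding receiver_counts_def by (simp only: list.map)
  then show ?thesis unfolding first rest .
qed

lemma arrangement_Cons: "\<exists>ys. arrangement i j ms n = Trans i # ys"
  by (cases ms) auto

lemma receiver_counts_arrangement:
  "receiver_counts (arrangement i j ms n @ [Hr]) = ms @ [n]"
proof (induction ms arbitrary: i j)
  case Nil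
  have "receiver_counts [Hr] = []" by (simp add: receiver_counts_def fences_def)
  then show ?case
    using receiver_counts_Cons_block[of "Trans i" Hr "[j..<j + n]" "[]"] by simp
next
  case (Cons m ms)
  obtain ys where ys: "arrangement (Suc i) (j + m) ms n = Trans (Suc i) # ys"
    using arrangement_Cons by blast
  have "receiver_counts (arrangement i j (m # ms) n @ [Hr])
      = m # receiver_counts (arrangement (Suc i) (j + m) ms n @ [Hr])"
    using receiver_counts_Cons_block[of "Trans i" "Trans (Suc i)" "[j..<j + m]" "ys @ [Hr]"] ys
    by simp
  then show ?case using Cons by simp
qed

lemma receiver_counts_deployed: "receiver_counts (deployed n0 ms n) = n0 # ms @ [n]"
proof -
  obtain ys where ys: "arrangement 0 n0 ms n = Trans 0 # ys"
    using arrangement_Cons by blast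
  have "receiver_counts (deployed n0 ms n) = n0 # receiver_counts (arrangement 0 n0 ms n @ [Hr])"
    using receiver_counts_Cons_block[of Hl "Trans 0" "[0..<n0]" "ys @ [Hr]"] ys
    by (simp add: deployed_def)
  then show ?thesis by (simp add: receiver_counts_arrangement)
qed

lemma covers_arrangement:
  assumes "0 \<le> c" "\<And>m. m \<in> set ms \<Longrightarrow> 1 \<le> m" "1 \<le> n"
  shows "covers c (arrangement i j ms n @ [Hr])
    (concat (map (section_gaps c) ms) @ ladder c n @ [end_gap c n])"
  using assms(2)
proof (induction ms arbitrary: i j)
  case Nil
  then show ?case using covers_end[of c "[j..<j + n]" n i Hr] assms by simp
next
  case (Cons m ms)
  obtain ys where ys: "arrangement (Suc i) (j + m) ms n = Trans (Suc i) # ys"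
    using arrangement_Cons by blast
  have "covers c ((Trans i # map Recv [j..<j + m]) @ [Trans (Suc i)]) (section_gaps c m)"
    using covers_section[of c "[j..<j + m]" m i "Suc i"] assms(1) Cons.prems by simp
  moreover have "covers c (Trans (Suc i) # ys @ [Hr])
      (concat (map (section_gaps c) ms) @ ladder c n @ [end_gap c n])"
    using Cons.IH[of "Suc i" "j + m"] Cons.prems ys by simp
  ultimately have "covers c ((Trans i # map Recv [j..<j + m]) @ Trans (Suc i) # ys @ [Hr])
      (section_gaps c m @ concat (map (section_gaps c) ms) @ ladder c n @ [end_gap c n])"
    by (rule covers_append)
  then show ?case using ys by simp
qed

lemma section_gaps_nonneg: "0 \<le> c \<Longrightarrow> d \<in> set (section_gaps c n) \<Longrightarrow> 0 \<le> d"
  by (auto simp: section_gaps_def dest: ladder_nonneg)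

lemma end_gap_nonneg: "0 \<le> c \<Longrightarrow> 0 \<le> end_gap c n"
  by (simp add: end_gap_def)

lemma sum_end: "2 * c * sqrt n + end_gap c n = c * end_len n"
  by (simp add: end_gap_def end_len_def algebra_simps)

lemma sum_sections: "sum_list (concat (map (section_gaps c) ms)) = c * (\<Sum>m\<leftarrow>ms. section_len m)"
  by (induction ms) (auto simp: algebra_simps)

lemma length_sections: "length (concat (map (section_gaps c) ms)) = sum_list ms + length ms"
  by (induction ms) auto

text \<open>The left end is a reflected right end, glued to the rest at the first transmitter. All
  lengths are proportional to \<open>c\<close>, so any total length can be reached.\<close>

lemma spacings_covering_deployed:
  assumes c: "0 \<le> c" and "1 \<le> n0" "\<And>m. m \<in> set ms \<Longrightarrow> 1 \<le> m" "1 \<le> n"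
  obtains D where "covers c (deployed n0 ms n) D"
    "D \<in> spacings (length ms + 1 + (n0 + sum_list ms + n))
       (c * (end_len n0 + (\<Sum>m\<leftarrow>ms. section_len m) + end_len n))"
proof -
  let ?D1 = "concat (map (section_gaps c) ms) @ ladder c n @ [end_gap c n]"
  let ?D0 = "end_gap c n0 # rev (ladder c n0)"
  obtain ys where ys: "arrangement 0 n0 ms n = Trans 0 # ys"
    using arrangement_Cons by blast
  have "covers c (rev (Trans 0 # map Recv (rev [0..<n0]) @ [Hl])) (rev (ladder c n0 @ [end_gap c n0]))"
    using assms by (intro covers_rev covers_end) auto
  then have "covers c ((Hl # map Recv [0..<n0]) @ [Trans 0]) ?D0"
    by (simp add: rev_map)
  moreover have "covers c (Trans 0 # ys @ [Hr]) ?D1"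
    using covers_arrangement[of c ms n 0 n0] assms ys by simp
  ultimately have "covers c ((Hl # map Recv [0..<n0]) @ Trans 0 # ys @ [Hr]) (?D0 @ ?D1)"
    by (rule covers_append)
  then have "covers c (deployed n0 ms n) (?D0 @ ?D1)"
    using ys by (simp add: deployed_def)
  moreover have "sum_list (?D0 @ ?D1) =
      c * (end_len n0 + (\<Sum>m\<leftarrow>ms. section_len m) + end_len n)"
    using sum_end[of c n0] sum_end[of c n]
    by (simp add: sum_sections sum_list_rev ring_distribs)
  moreover have "length (?D0 @ ?D1) = length ms + 1 + (n0 + sum_list ms + n) + 1"
    by (simp add: length_sections)
  moreover have "\<forall>d\<in>set (?D0 @ ?D1). 0 \<le> d"
    using c by (auto dest: ladder_nonneg section_gaps_nonneg simp: end_gap_nonneg)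
  ultimately show thesis using that by (auto simp: spacings_def)
qed

section \<open>Alternating deployments for equal numbers of both types\<close>

lemma covers_pair:
  assumes "0 \<le> c" "is_Trans u \<and> is_Recv v \<or> is_Recv u \<and> is_Trans v"
  shows "covers c [u, v] [2 * c]"
proof -
  have "covered_at c [u, v] [2 * c] p" if p: "0 \<le> p" "p \<le> 2 * c" for p
  proof -
    have "0 \<le> (p - c)\<^sup>2" by simp
    then have "p * (2 * c - p) \<le> c\<^sup>2" by (simp add: power2_eq_square algebra_simps)
    then have "\<bar>loc [2 * c] 0 - p\<bar> * \<bar>loc [2 * c] 1 - p\<bar> \<le> c\<^sup>2"
      using p by (simp add: loc_def)
    with assms(2) show ?thesis
      using covered_atI[of 0 "[u, v]" 1 "[2 * c]" p c] covered_atI[of 1 "[u, v]" 0 "[2 * c]" p c]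
      by (auto simp: mult.commute)
  qed
  then show ?thesis by (simp add: covers_def)
qed

text \<open>After the pair, the product grows up to \<open>w\<close>, where it is
  \<open>c\<^sup>2\<close> because \<open>(sqrt 2 + 1) * (sqrt 2 - 1) = 1\<close>.\<close>

lemma covers_triple:
  assumes "0 \<le> c" "is_Trans u \<and> is_Recv v \<or> is_Recv u \<and> is_Trans v"
  shows "covers c [u, v, w] [2 * c, end_gap c 1]"
proof -
  let ?D = "[2 * c, end_gap c 1]"
  have "covered_at c [u, v, w] ?D p" if p: "0 \<le> p" "p \<le> 2 * c + end_gap c 1" for p
  proof (cases "p \<le> 2 * c")
    case True
    then have "covered_at c ([u, v] @ [w]) ([2 * c] @ [end_gap c 1]) p"
      using covers_pair[OF assms] p(1) unfolding covers_def
      by (intro covered_at_append_right) auto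
    then show ?thesis by simp
  next
    case False
    have "p * (p - 2 * c) \<le> (c * (sqrt 2 + 1)) * (c * (sqrt 2 - 1))"
      using False p assms(1) by (intro mult_mono) (auto simp: end_gap_def algebra_simps)
    also have "\<dots> = c\<^sup>2 * ((sqrt 2)\<^sup>2 - 1)"
      by (simp only: power2_eq_square) algebra
    also have "\<dots> = c\<^sup>2" by simp
    finally have "\<bar>loc ?D 0 - p\<bar> * \<bar>loc ?D 1 - p\<bar> \<le> c\<^sup>2"
      using False p(1) by (simp add: loc_def)
    with assms(2) show ?thesis
      using covered_atI[of 0 "[u, v, w]" 1 ?D p c] covered_atI[of 1 "[u, v, w]" 0 ?D p c]
      by (auto simp: mult.commute)
  qed
  then show ?thesis by (simp add: covers_def)
qed

text \<open>Each gap of length \<open>2 * c\<close> is covered by its own two nodes, and the last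
  such pair also covers the end gap. The count after the last transmitter is 0, a case outside
  \<open>covers_end\<close>.\<close>

lemma covers_alternating:
  assumes c: "0 \<le> c"
  shows "covers c (Recv a # arrangement i j (replicate k 1) 0 @ [Hr])
    (2 * c # concat (replicate k [2 * c, 2 * c]) @ [end_gap c 1])"
proof (induction k arbitrary: a i j)
  case 0
  show ?case using covers_triple[OF c, of "Recv a" "Trans i" Hr] by simp
next
  case (Suc k)
  let ?A = "arrangement (Suc i) (j + 1) (replicate k 1) 0 @ [Hr]"
  let ?D = "2 * c # concat (replicate k [2 * c, 2 * c]) @ [end_gap c 1]"
  have "covers c ([Trans i] @ Recv j # ?A) ([2 * c] @ ?D)"
    using covers_pair[OF c, of "Trans i" "Recv j"] by (intro covers_append Suc.IH) simp
  then have "covers c ([Recv a] @ Trans i # Recv j # ?A) ([2 * c] @ 2 * c # ?D)"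
    using covers_pair[OF c, of "Recv a" "Trans i"] by (intro covers_append) simp_all
  then show ?case by simp
qed

lemma spacings_covering_alternating:
  assumes c: "0 \<le> c"
  obtains D where "covers c (deployed 1 (replicate k 1) 0) D"
    "D \<in> spacings (2 * Suc k) (c * (4 * real k + 2 * sqrt 2))"
proof -
  let ?D1 = "2 * c # concat (replicate k [2 * c, 2 * c]) @ [end_gap c 1]"
  let ?D = "end_gap c 1 # ?D1"
  let ?S = "deployed 1 (replicate k 1) 0"
  obtain ys where ys: "arrangement 0 1 (replicate k 1) 0 = Trans 0 # ys"
    using arrangement_Cons by blast
  then have S: "?S = Hl # Recv 0 # Trans 0 # ys @ [Hr]"
    by (simp add: deployed_def)
  have rest: "covers c (Recv 0 # Trans 0 # ys @ [Hr]) ?D1"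
    using covers_alternating[OF c, of 0 0 1 k] ys by simp
  have "covers c (rev [Trans 0, Recv 0, Hl]) (rev [2 * c, end_gap c 1])"
    using covers_triple[OF c] by (intro covers_rev) simp
  then have front: "covers c [Hl, Recv 0, Trans 0] [end_gap c 1, 2 * c]" by simp
  \<comment> \<open>The two fragments overlap in the pair \<open>Recv 0\<close>,
    \<open>Trans 0\<close> instead of sharing a single node; the front one serves only for the left
    end gap.\<close>
  have "covered_at c ?S ?D p" if p: "0 \<le> p" "p \<le> sum_list ?D" for p
  proof (cases "p \<le> end_gap c 1")
    case True
    have "covered_at c ([Hl, Recv 0, Trans 0] @ ys @ [Hr])
        ([end_gap c 1, 2 * c] @ concat (replicate k [2 * c, 2 * c]) @ [end_gap c 1]) p"
      using front True p(1) c unfolding covers_def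
      by (intro covered_at_append_right) auto
    then show ?thesis unfolding S by simp
  next
    case False
    have "covered_at c ([Hl] @ Recv 0 # Trans 0 # ys @ [Hr]) ([end_gap c 1] @ ?D1) p"
      using rest False p(2) unfolding covers_def
      by (intro covered_at_append_left) auto
    then show ?thesis unfolding S by simp
  qed
  then have "covers c ?S ?D"
    using rest unfolding covers_def S by auto
  moreover have "sum_list (concat (replicate k [2 * c, 2 * c])) = 4 * c * real k"
    by (induction k) (auto simp: algebra_simps)
  then have "sum_list ?D = c * (4 * real k + 2 * sqrt 2)"
    by (simp add: end_gap_def algebra_simps)
  moreover have "length (concat (replicate k [2 * c, 2 * c])) = 2 * k"
    by (induction k) auto
  then have "length ?D = 2 * Suc k + 1" by simp
  moreover have "\<forall>d\<in>set ?D. 0 \<le> d"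
    using c by (auto simp: end_gap_nonneg)
  ultimately show thesis using that by (auto simp: spacings_def)
qed

subsection \<open>Optimal orders\<close>

lemma I_val_le_iff:
  assumes "1 \<le> M" "1 \<le> N" "S \<in> orders M N"
  shows "I_val S D p \<le> c\<^sup>2 \<longleftrightarrow> covered_at c S D p"
proof -
  let ?A = "{(i, j). i < length S \<and> j < length S \<and> is_Trans (S ! i) \<and> is_Recv (S ! j)}"
  let ?V = "(\<lambda>(i, j). \<bar>loc D i - p\<bar> * \<bar>loc D j - p\<bar>) ` ?A"
  have V: "{\<bar>loc D i - p\<bar> * \<bar>loc D j - p\<bar> | i j.
      i < length S \<and> j < length S \<and> is_Trans (S ! i) \<and> is_Recv (S ! j)} = ?V"
    by auto
  have "finite ?A"
    by (rule finite_subset[of _ "{..<length S} \<times> {..<length S}"]) auto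
  then have "finite ?V" by (rule finite_imageI)
  moreover have "?V \<noteq> {}"
  proof -
    have "Trans 0 \<in> set S" "Recv 0 \<in> set S"
      using assms by (auto simp: orders_def nodes_def permutations_of_set_def)
    then obtain i j where "i < length S" "S ! i = Trans 0" "j < length S" "S ! j = Recv 0"
      by (auto simp: in_set_conv_nth)
    then have "(i, j) \<in> ?A" by auto
    then show ?thesis by blast
  qed
  ultimately have "I_val S D p \<le> c\<^sup>2 \<longleftrightarrow> (\<exists>v\<in>?V. v \<le> c\<^sup>2)"
    unfolding I_val_def V by (rule Min_le_iff)
  also have "\<dots> \<longleftrightarrow> covered_at c S D p"
    unfolding covered_at_def by auto
  finally show ?thesis .
qed

text \<open>Scaling: \<open>F\<close> bounds the length that can be covered with
  \<open>c = 1\<close>. The candidate covers with \<open>c = h / F\<close>, so its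
  \<open>Q_val\<close> is at most \<open>(h / F)\<^sup>2\<close>; a rival covers with the root of
  its own \<open>Q_val\<close>, which \<open>bound\<close> shows to be at least
  \<open>h / F\<close>.\<close>

lemma optimal_orderI:
  assumes "1 \<le> M" "1 \<le> N" "0 < h" "0 < F"
    and S: "S \<in> orders M N" and D: "D \<in> spacings (M + N) h" and covers: "covers (h / F) S D"
    and bound: "\<And>S' D' c. \<lbrakk>S' \<in> orders M N; D' \<in> spacings (M + N) h; 0 \<le> c;
      \<And>p. p \<in> {0..h} \<Longrightarrow> covered_at c S' D' p\<rbrakk> \<Longrightarrow> h \<le> c * F"
  shows "optimal_order M N h S"
proof -
  have "Q_val S D \<le> (h / F)\<^sup>2"
  proof -
    obtain p where "p \<in> {0..h}" "Q_val S D = I_val S D p"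
      using Q_val_attained[OF assms(1,2) S D] \<open>0 < h\<close> by auto
    moreover have "sum_list D = h" using D by (simp add: spacings_def)
    ultimately show ?thesis
      using covers I_val_le_iff[OF assms(1,2) S] unfolding covers_def by simp
  qed
  moreover have "(h / F)\<^sup>2 \<le> Q_val S' D'" if S': "S' \<in> orders M N" "D' \<in> spacings (M + N) h" for S' D'
  proof -
    \<comment> \<open>The maximum with 0 settles the sign under the root; it disappears at the end
      because \<open>h / F\<close> is positive.\<close>
    define c where "c = sqrt (max 0 (Q_val S' D'))"
    have c: "c\<^sup>2 = max 0 (Q_val S' D')" "0 \<le> c" by (auto simp: c_def)
    have "covered_at c S' D' p" if "p \<in> {0..h}" for p
    proof -
      have "I_val S' D' p \<le> Q_val S' D'"
        using Q_val_attained[OF assms(1,2) S'] \<open>0 < h\<close> that by auto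
      then have "I_val S' D' p \<le> c\<^sup>2" using c by simp
      then show ?thesis using I_val_le_iff[OF assms(1,2) S'(1)] by blast
    qed
    then have "h \<le> c * F" using bound S' c by blast
    then have "h / F \<le> c" using \<open>0 < F\<close> by (simp add: pos_divide_le_eq)
    then have "(h / F)\<^sup>2 \<le> c\<^sup>2" using assms by (intro power_mono) auto
    moreover have "0 < (h / F)\<^sup>2" using assms by simp
    ultimately show ?thesis using c by (simp add: max_def split: if_splits)
  qed
  ultimately show ?thesis
    using S D unfolding optimal_order_def by (meson order_trans)
qed

definition transmitter_places :: "node list \<Rightarrow> nat set" where
  "transmitter_places S = {k. k < length S \<and> is_Trans (S ! k)}"

lemma card_transmitter_places:
  assumes "S \<in> orders M N"
  shows "card (transmitter_places S) = M"
proof -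
  obtain s where s: "S = Hl # s @ [Hr]" "set s = nodes M N" "distinct s"
    using assms by (auto simp: orders_def permutations_of_set_def)
  have "card (transmitter_places S) = length (filter is_Trans S)"
    by (simp add: transmitter_places_def length_filter_conv_card)
  also have "\<dots> = card (set (filter is_Trans s))"
    using s distinct_card[of "filter is_Trans s"] by simp
  also have "set (filter is_Trans s) = Trans ` {..<M}"
    using s by (auto simp: nodes_def)
  also have "card \<dots> = M"
    by (subst card_image) (auto simp: inj_on_def)
  finally show ?thesis .
qed

lemma length_order: "S \<in> orders M N \<Longrightarrow> length S = M + N + 2"
proof -
  assume "S \<in> orders M N"
  then obtain s where s: "S = Hl # s @ [Hr]" "set s = nodes M N" "distinct s"
    by (auto simp: orders_def permutations_of_set_def)
  have "card (nodes M N) = M + N"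
    unfolding nodes_def
    by (subst card_Un_disjoint) (auto simp: card_image inj_on_def)
  then have "length s = M + N" using s distinct_card by metis
  then show ?thesis using s by simp
qed

lemma order_ends:
  assumes "S \<in> orders M N"
  shows "S ! 0 = Hl" "S ! (Suc (M + N)) = Hr"
proof -
  obtain s where s: "S = Hl # s @ [Hr]" using assms by (auto simp: orders_def)
  moreover have "length s = M + N" using length_order[OF assms] s by simp
  ultimately show "S ! 0 = Hl" "S ! (Suc (M + N)) = Hr" by (auto simp: nth_append)
qed

text \<open>Places in the list serve as the indices of the locale. The end nodes are neither
  transmitters nor receivers, so both types occupy only places 1 to \<open>M + N\<close>.\<close>

lemma order_deployment:
  assumes S: "S \<in> orders M N" and D: "D \<in> spacings (M + N) h" and c: "0 \<le> c"
    and cov: "\<And>p. p \<in> {0..h} \<Longrightarrow> covered_at c S D p"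
  shows "deployment (loc D) (M + N) (transmitter_places S) c" "loc D (Suc (M + N)) = h"
proof -
  have D: "length D = M + N + 1" "\<And>d. d \<in> set D \<Longrightarrow> 0 \<le> d" "sum_list D = h"
    using D by (auto simp: spacings_def)
  note len = length_order[OF S] and ends = order_ends[OF S]
  show end_loc: "loc D (Suc (M + N)) = h" using D by (simp add: loc_def)
  have inner: "k \<in> {1..M + N}" if "k < length S" "\<not> is_Hl (S ! k)" "\<not> is_Hr (S ! k)" for k
  proof -
    have "k \<noteq> 0" "k \<noteq> Suc (M + N)" using that ends by (metis node.disc(1), metis node.disc(6))
    then show ?thesis using that len by auto
  qed
  have not_end: "\<not> is_Hl v" "\<not> is_Hr v" if "is_Trans v \<or> is_Recv v" for v
    using that by (cases v; simp)+
  show "deployment (loc D) (M + N) (transmitter_places S) c"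
  proof
    fix i j :: nat assume "i \<le> j"
    then have "loc D j = loc D i + sum_list (take (j - i) (drop i D))"
      unfolding loc_def by (metis le_add_diff_inverse sum_list_append take_add)
    moreover have "0 \<le> sum_list (take (j - i) (drop i D))"
      using D(2) by (intro sum_list_nonneg) (metis in_set_dropD in_set_takeD)
    ultimately show "loc D i \<le> loc D j" by simp
  next
    show "loc D 0 = 0" by (simp add: loc_def)
    show "transmitter_places S \<subseteq> {1..M + N}"
      unfolding transmitter_places_def using inner not_end by blast
    show "0 \<le> c" by fact
  next
    fix p assume "0 \<le> p" "p \<le> loc D (Suc (M + N))"
    then have "covered_at c S D p" using cov end_loc by simp
    then obtain i j where ij: "i < length S" "j < length S" "is_Trans (S ! i)" "is_Recv (S ! j)"
      "\<bar>loc D i - p\<bar> * \<bar>loc D j - p\<bar> \<le> c\<^sup>2"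
      by (auto simp: covered_at_def)
    have "i \<in> transmitter_places S" using ij by (simp add: transmitter_places_def)
    moreover have "j \<in> {1..M + N}" using inner not_end ij by blast
    moreover have "j \<notin> transmitter_places S"
      using ij(4) by (cases "S ! j") (auto simp: transmitter_places_def)
    ultimately show "\<exists>i\<in>transmitter_places S. \<exists>j\<in>{1..M + N} - transmitter_places S.
        \<bar>loc D i - p\<bar> * \<bar>loc D j - p\<bar> \<le> c\<^sup>2"
      using ij(5) by blast
  qed
qed

text \<open>This is \<open>length_bound\<close> with penalty 0, carried over to orders.\<close>

lemma affine_bound:
  fixes A B lam :: real
  assumes "1 \<le> M" and S: "S \<in> orders M N" and "D \<in> spacings (M + N) h" "0 \<le> c"
    and "\<And>p. p \<in> {0..h} \<Longrightarrow> covered_at c S D p"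
    and "\<And>i j n. i + j = n + 1 \<Longrightarrow> 2 * (sqrt (real i) + sqrt (real j)) \<le> A + lam * real n"
    and "\<And>n. end_len n \<le> B + lam * real n"
  shows "h \<le> c * (2 * B + A * (real M - 1) + lam * real N)"
proof -
  interpret deployment "loc D" "M + N" "transmitter_places S" c
    using order_deployment assms(2-5) by blast
  have "transmitter_places S \<noteq> {}" using card_transmitter_places[OF S] assms(1) by auto
  then have "loc D (Suc (M + N)) \<le> c * (2 * B + A * (real M - 1) + lam * real N)"
    using length_bound[of A lam 0 B] assms(6,7) card_transmitter_places[OF S] by simp
  then show ?thesis using order_deployment(2) assms(2-5) by metis
qed

text \<open>The secant through \<open>k\<close> and \<open>k + 1\<close> is applied to both roots of
  every piece. The resulting lines are exact at count \<open>k\<close> for an end and, if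
  \<open>1 \<le> k\<close>, at counts \<open>2 * k - 1\<close>, \<open>2 * k\<close> and
  \<open>2 * k + 1\<close> for a section. This serves \<open>q = 2 * k\<close>, and
  \<open>q = 2 * k - 1\<close> with positive remainder.\<close>

lemma bound_from_secant:
  assumes "1 \<le> M" "S \<in> orders M N" "D \<in> spacings (M + N) h" "0 \<le> c"
    and "\<And>p. p \<in> {0..h} \<Longrightarrow> covered_at c S D p"
  shows "h \<le> c * (2 * end_len k + (real M - 1) * section_len (2 * k)
    + 2 * (sqrt (k + 1) - sqrt k) * (real N - 2 * real k * real M))"
proof -
  let ?d = "sqrt (k + 1) - sqrt k"
  have len: "section_len (2 * k) = 2 * (sqrt (k + 1) + sqrt k)" by (simp add: section_len_def)
  have "h \<le> c * (2 * (end_len k - 2 * ?d * real k)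
      + (section_len (2 * k) - 4 * ?d * real k) * (real M - 1) + 2 * ?d * real N)"
  proof (rule affine_bound[OF assms])
    fix i j n :: nat assume "i + j = n + 1"
    then have n: "real n = real i + real j - 1" by linarith
    show "2 * (sqrt (real i) + sqrt (real j)) \<le> section_len (2 * k) - 4 * ?d * real k + 2 * ?d * real n"
      using sqrt_secant[of i k] sqrt_secant[of j k] unfolding len n
      by (simp add: algebra_simps)
  next
    fix n show "end_len n \<le> end_len k - 2 * ?d * real k + 2 * ?d * real n"
      using sqrt_secant[of n k] sqrt_secant[of "n + 1" k]
      by (simp add: end_len_def algebra_simps)
  qed
  also have "\<dots> = c * (2 * end_len k + (real M - 1) * section_len (2 * k)
      + 2 * ?d * (real N - 2 * real k * real M))"
    by (simp add: algebra_simps)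
  finally show ?thesis .
qed

text \<open>The slope per receiver is the mean of those in \<open>bound_from_secant\<close> for
  \<open>k\<close> and \<open>k + 1\<close>. For sections the two secants are averaged; they meet at
  \<open>i = j = k + 1\<close>, that is, at count \<open>2 * k + 1\<close>. At an end each root gets
  one of the secants, which makes the line exact at both \<open>k\<close> and
  \<open>k + 1\<close>.\<close>

lemma bound_from_tangent:
  assumes "1 \<le> M" "S \<in> orders M N" "D \<in> spacings (M + N) h" "0 \<le> c"
    and "\<And>p. p \<in> {0..h} \<Longrightarrow> covered_at c S D p" and N: "N = (2 * k + 1) * M"
  shows "h \<le> c * (end_len (k + 1) + (real M - 1) * section_len (2 * k + 1) + end_len k)"
proof -
  let ?d = "sqrt (k + 2) - sqrt k"
  have len: "section_len (2 * k + 1) = 4 * sqrt (k + 1)" by (simp add: section_len_def)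
  have "h \<le> c * (2 * (end_len k - ?d * real k)
      + (section_len (2 * k + 1) - ?d * real (2 * k + 1)) * (real M - 1) + ?d * real N)"
  proof (rule affine_bound[OF assms(1-5)])
    fix i j n :: nat assume "i + j = n + 1"
    then have n: "real n = real i + real j - 1" by linarith
    show "2 * (sqrt (real i) + sqrt (real j))
        \<le> section_len (2 * k + 1) - ?d * real (2 * k + 1) + ?d * real n"
      using sqrt_secant[of i k] sqrt_secant[of j k]
        sqrt_secant[of i "k + 1"] sqrt_secant[of j "k + 1"] unfolding len n
      by (simp add: algebra_simps)
  next
    fix n show "end_len n \<le> end_len k - ?d * real k + ?d * real n"
      using sqrt_secant[of n k] sqrt_secant[of "n + 1" "k + 1"]
      by (simp add: end_len_def algebra_simps)
  qed
  also have "\<dots> = c * (end_len (k + 1) + (real M - 1) * section_len (2 * k + 1) + end_len k)"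
    unfolding N by (simp add: end_len_def algebra_simps)
  finally show ?thesis .
qed

text \<open>Either two neighbours have the same type and the penalty brings the affine bound down to
  the alternating length, or the order alternates and \<open>alternating_bound\<close>
  applies.\<close>

lemma bound_equal_numbers:
  assumes "1 \<le> M" and S: "S \<in> orders M M" and "D \<in> spacings (M + M) h" "0 \<le> c"
    and "\<And>p. p \<in> {0..h} \<Longrightarrow> covered_at c S D p"
  shows "h \<le> c * (4 * (real M - 1) + 2 * sqrt 2)"
proof -
  let ?T = "transmitter_places S"
  interpret deployment "loc D" "M + M" ?T c
    using order_deployment assms(2-5) by blast
  have h: "loc D (Suc (M + M)) = h" using order_deployment(2) assms(2-5) by blast
  note card = card_transmitter_places[OF S]
  have sqrt2: "sqrt 2 \<le> 2" using sqrt_le_D[of 2 2] real_sqrt_le_iff[of 2 4] by simp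
  \<comment> \<open>For \<open>n \<ge> 2\<close> this is the difference between the penalized line
    and the secant bound through 1 and 2, for sections and ends alike.\<close>
  have rest: "0 \<le> (2 - sqrt 2) * (real n - 2)" if "2 \<le> n" for n :: nat
    using that sqrt2 by simp
  show ?thesis
  proof (cases "\<exists>k\<ge>1. k < M + M \<and> (k \<in> ?T \<longleftrightarrow> Suc k \<in> ?T)")
    case True
    \<comment> \<open>The lines are exact at one receiver in a section and at zero or one at an end.
      The penalty \<open>2 - sqrt 2\<close> is the excess of the sum
      \<open>4 * (M - 1) + 2 + sqrt 2\<close> of these lines over the alternating length.\<close>
    have "loc D (Suc (M + M)) \<le> c * (2 * 1 + (4 - sqrt 2) * (real (card ?T) - 1)
        + sqrt 2 * real (M + M - card ?T)
        - (if \<exists>k\<ge>1. k < M + M \<and> (k \<in> ?T \<longleftrightarrow> Suc k \<in> ?T) then 2 - sqrt 2 else 0))"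
    proof (rule length_bound)
      fix i j n :: nat assume ij: "i + j = n + 1"
      then have n: "real n = real i + real j - 1" by linarith
      show "2 * (sqrt (real i) + sqrt (real j))
          \<le> 4 - sqrt 2 + sqrt 2 * real n - (if n = 1 then 0 else 2 - sqrt 2)"
      proof (cases "n = 0")
        case True
        then have "i = 0 \<and> j = 1 \<or> i = 1 \<and> j = 0" using ij by auto
        then show ?thesis using True by auto
      next
        case False
        have "2 * (sqrt i + sqrt j) \<le> 4 + 2 * (sqrt 2 - 1) * (real n - 1)"
          using sqrt_secant[of i 1] sqrt_secant[of j 1] unfolding n by (simp add: algebra_simps)
        then show ?thesis using False rest[of n] by (cases "n = 1") (auto simp: algebra_simps)
      qed
    next
      fix n :: nat
      show "end_len n \<le> 1 + sqrt 2 * real n - (if n \<le> 1 then 0 else 2 - sqrt 2)"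
      proof (cases "n \<le> 1")
        case True
        then have "n = 0 \<or> n = 1" by auto
        then show ?thesis by (auto simp: end_len_def)
      next
        case False
        then show ?thesis
          using sqrt_secant[of n 1] sqrt_secant[of "n + 1" 1] rest[of n]
          by (simp add: end_len_def algebra_simps)
      qed
    next
      show "0 \<le> 2 - sqrt 2" using sqrt2 by simp
      show "?T \<noteq> {}" using card assms(1) by auto
    qed
    then show ?thesis using True unfolding h card by (simp add: algebra_simps)
  next
    case False
    then have "loc D (Suc (M + M)) \<le> c * (2 * real (M + M) - 4 + 2 * sqrt 2)"
      using assms(1) by (intro alternating_bound) auto
    then show ?thesis unfolding h by (simp add: algebra_simps)
  qed
qed

lemma end_len_pos: "0 < end_len n"
  by (simp add: end_len_def add_nonneg_pos)

text \<open>With \<open>c = h / ?F\<close> the construction has length exactly \<open>h\<close>,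
  which reduces optimality to the matching upper bound.\<close>

lemma optimal_deployed:
  assumes "0 < h" "1 \<le> n0" "\<And>m. m \<in> set ms \<Longrightarrow> 1 \<le> m" "1 \<le> n"
    and M: "M = length ms + 1" and N: "N = n0 + sum_list ms + n"
    and bound: "\<And>S D c. \<lbrakk>S \<in> orders M N; D \<in> spacings (M + N) h; 0 \<le> c;
      \<And>p. p \<in> {0..h} \<Longrightarrow> covered_at c S D p\<rbrakk> \<Longrightarrow>
      h \<le> c * (end_len n0 + (\<Sum>m\<leftarrow>ms. section_len m) + end_len n)"
  shows "optimal_order M N h (deployed n0 ms n)"
proof -
  let ?F = "end_len n0 + (\<Sum>m\<leftarrow>ms. section_len m) + end_len n"
  have "0 \<le> (\<Sum>m\<leftarrow>ms. section_len m)"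
    by (intro sum_list_nonneg) (auto simp: section_len_def)
  then have F: "0 < ?F" using end_len_pos[of n0] end_len_pos[of n] by simp
  obtain D where D: "covers (h / ?F) (deployed n0 ms n) D" "D \<in> spacings (M + N) (h / ?F * ?F)"
    using spacings_covering_deployed[of "h / ?F" n0 ms n] assms F by (metis less_imp_le zero_less_divide_iff)
  show ?thesis
  proof (rule optimal_orderI)
    show "deployed n0 ms n \<in> orders M N" unfolding M N by (rule deployed_in_orders)
    show "D \<in> spacings (M + N) h" using D(2) F by simp
    show "covers (h / ?F) (deployed n0 ms n) D" by (rule D)
  qed (use assms F in auto)
qed

lemma optimal_alternating:
  assumes "0 < h" "1 \<le> M"
  shows "optimal_order M M h (deployed 1 (replicate (M - 1) 1) 0)"
proof -
  let ?F = "4 * (real M - 1) + 2 * sqrt 2"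
  have F: "0 < ?F" using assms by (intro add_nonneg_pos) auto
  obtain D where D: "covers (h / ?F) (deployed 1 (replicate (M - 1) 1) 0) D"
      "D \<in> spacings (2 * Suc (M - 1)) (h / ?F * (4 * real (M - 1) + 2 * sqrt 2))"
    using spacings_covering_alternating[of "h / ?F" "M - 1"] assms F
    by (metis less_imp_le zero_less_divide_iff)
  have "real (M - 1) = real M - 1" "2 * Suc (M - 1) = M + M" using assms by auto
  then have "D \<in> spacings (M + M) (h / ?F * ?F)" using D(2) by metis
  then have D': "D \<in> spacings (M + M) h" using F by simp
  show ?thesis
  proof (rule optimal_orderI)
    show "deployed 1 (replicate (M - 1) 1) 0 \<in> orders M M"
      using deployed_in_orders[of 1 "replicate (M - 1) 1" 0] assms by (simp add: sum_list_replicate)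
    show "h \<le> c * ?F" if "S' \<in> orders M M" "D' \<in> spacings (M + M) h" "0 \<le> c"
      "\<And>p. p \<in> {0..h} \<Longrightarrow> covered_at c S' D' p" for S' D' c
      using bound_equal_numbers[OF assms(2) that] .
  qed (use assms F D(1) D' in auto)
qed

theorem mainTheorem5:
  fixes M N q r :: nat and h :: real
  assumes "1 \<le> M" and "M \<le> N" and "0 < h"
    and "q = N div M" and "r = N mod M"
  shows "\<exists>S. optimal_order M N h S \<and>
    (even q \<longrightarrow> receiver_counts S =
       [q div 2] @ replicate r (q + 1) @ replicate (M - 1 - r) q @ [q div 2]) \<and>
    (odd q \<and> r = 0 \<longrightarrow> receiver_counts S =
       [(q + 1) div 2] @ replicate (M - 1) q @ [(q - 1) div 2]) \<and>
    (odd q \<and> 1 \<le> r \<longrightarrow> receiver_counts S =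
       [(q + 1) div 2] @ replicate (r - 1) (q + 1) @ replicate (M - r) q @ [(q + 1) div 2])"
proof -
  have N: "N = q * M + r" and r: "r < M" using assms by simp_all
  have "1 \<le> q" using assms by (simp add: Suc_le_eq div_greater_zero_iff)
  \<comment> \<open>Odd \<open>q\<close> with \<open>r = 0\<close> is split because the last count
    \<open>(q - 1) div 2\<close> vanishes exactly for \<open>q = 1\<close>, where the order
    alternates.\<close>
  consider (even) "even q" | (equal) "q = 1" "r = 0" | (exact) "odd q" "3 \<le> q" "r = 0"
    | (odd) "odd q" "1 \<le> r"
  proof -
    have "q = 1 \<or> 3 \<le> q" if "odd q" using that by (cases q rule: nat.exhaust) (auto elim!: oddE)
    then show thesis using that by fastforce
  qed
  then show ?thesis
  proof cases
    case even
    then obtain k where k: "q = 2 * k" "1 \<le> k" using \<open>1 \<le> q\<close> by (auto elim!: evenE)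
    define ms where "ms = replicate r (q + 1) @ replicate (M - 1 - r) q"
    \<comment> \<open>One more receiver in a section gains exactly the slope of
      \<open>bound_from_secant\<close>, so the \<open>r\<close> larger sections account for the
      surplus \<open>N - 2 * k * M = r\<close>.\<close>
    have len: "section_len (2 * k + 1) = section_len (2 * k) + 2 * (sqrt (k + 1) - sqrt k)"
      by (simp add: section_len_def)
    have Mr: "real (M - 1 - r) = real M - 1 - real r" using r by linarith
    have "(\<Sum>m\<leftarrow>ms. section_len m)
        = real r * section_len (2 * k + 1) + real (M - 1 - r) * section_len (2 * k)"
      by (simp add: ms_def k sum_list_replicate)
    also have "\<dots> = (real M - 1) * section_len (2 * k) + 2 * (sqrt (k + 1) - sqrt k) * real r"
      unfolding len Mr by (simp add: algebra_simps)
    finally have sum: "(\<Sum>m\<leftarrow>ms. section_len m)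
        = (real M - 1) * section_len (2 * k) + 2 * (sqrt (k + 1) - sqrt k) * real r" .
    have "optimal_order M N h (deployed k ms k)"
    proof (rule optimal_deployed)
      show "N = k + sum_list ms + k"
      proof -
        obtain d where "M = r + d + 1" using r less_imp_Suc_add[of r M] by auto
        then show ?thesis using N k by (simp add: ms_def sum_list_replicate algebra_simps)
      qed
      show "h \<le> c * (end_len k + (\<Sum>m\<leftarrow>ms. section_len m) + end_len k)"
        if "S \<in> orders M N" "D \<in> spacings (M + N) h" "0 \<le> c"
          "\<And>p. p \<in> {0..h} \<Longrightarrow> covered_at c S D p" for S D c
        using bound_from_secant[OF assms(1) that, of k] N k unfolding sum
        by (simp add: algebra_simps)
    qed (use assms k r in \<open>auto simp: ms_def\<close>)
    moreover have "receiver_counts (deployed k ms k)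
        = [q div 2] @ replicate r (q + 1) @ replicate (M - 1 - r) q @ [q div 2]"
      using k by (simp add: receiver_counts_deployed ms_def)
    ultimately show ?thesis using even by blast
  next
    case equal
    have "optimal_order M N h (deployed 1 (replicate (M - 1) 1) 0)"
      using optimal_alternating[of h M] N equal assms by simp
    moreover have "receiver_counts (deployed 1 (replicate (M - 1) 1) 0)
        = [(q + 1) div 2] @ replicate (M - 1) q @ [(q - 1) div 2]"
      using equal by (simp add: receiver_counts_deployed)
    ultimately show ?thesis using equal by auto
  next
    case exact
    then obtain k where k: "q = 2 * k + 1" "1 \<le> k" by (auto elim!: oddE)
    define ms where "ms = replicate (M - 1) q"
    have sum: "(\<Sum>m\<leftarrow>ms. section_len m) = (real M - 1) * section_len (2 * k + 1)"
      using k assms(1) by (simp add: ms_def sum_list_replicate of_nat_diff)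
    have "optimal_order M N h (deployed (k + 1) ms k)"
    proof (rule optimal_deployed)
      show "N = k + 1 + sum_list ms + k"
      proof -
        obtain d where "M = d + 1" using assms(1) by (metis add.commute le_Suc_ex)
        then show ?thesis using N k exact by (simp add: ms_def sum_list_replicate algebra_simps)
      qed
      show "h \<le> c * (end_len (k + 1) + (\<Sum>m\<leftarrow>ms. section_len m) + end_len k)"
        if "S \<in> orders M N" "D \<in> spacings (M + N) h" "0 \<le> c"
          "\<And>p. p \<in> {0..h} \<Longrightarrow> covered_at c S D p" for S D c
        using bound_from_tangent[OF assms(1) that, of k] N k exact unfolding sum by simp
    qed (use assms k in \<open>auto simp: ms_def\<close>)
    moreover have "receiver_counts (deployed (k + 1) ms k)
        = [(q + 1) div 2] @ replicate (M - 1) q @ [(q - 1) div 2]"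
      using k by (simp add: receiver_counts_deployed ms_def)
    ultimately show ?thesis using exact by auto
  next
    case odd
    then have "even (q + 1)" by simp
    then obtain k where "q + 1 = 2 * k" by (rule evenE)
    moreover from this have "1 \<le> k" by linarith
    ultimately have k: "q + 1 = 2 * k" "1 \<le> k" .
    define ms where "ms = replicate (r - 1) (q + 1) @ replicate (M - r) q"
    have "(q + 2) div 2 = k" "(q + 1) div 2 = k" using k by auto
    then have len: "section_len q = section_len (2 * k) - 2 * (sqrt (k + 1) - sqrt k)"
      by (simp add: section_len_def)
    have Mr: "real (M - r) = real M - real r" "real (r - 1) = real r - 1" using r odd by linarith+
    \<comment> \<open>Here \<open>q = 2 * k - 1\<close>, so over the reals
      \<open>N - 2 * k * M = r - M\<close>: each of the \<open>M - r\<close> sections with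
      \<open>q\<close> receivers loses the slope once compared to count
      \<open>2 * k\<close>.\<close>
    have sum: "(\<Sum>m\<leftarrow>ms. section_len m)
        = (real M - 1) * section_len (2 * k) + 2 * (sqrt (k + 1) - sqrt k) * (real r - real M)"
      using Mr by (simp add: ms_def sum_list_replicate len k(1)[simplified] algebra_simps)
    have q: "real q = 2 * real k - 1" using k(1) by linarith
    have "optimal_order M N h (deployed k ms k)"
    proof (rule optimal_deployed)
      show "N = k + sum_list ms + k"
      proof -
        obtain d e where "M = r + d" "r = e + 1"
          using r odd by (metis add.commute le_Suc_ex less_imp_le)
        then have "N = q * (e + 1 + d) + e + 1" "sum_list ms = e * (q + 1) + d * q"
          using N by (simp_all add: ms_def sum_list_replicate)
        then show ?thesis using k(1) by (simp add: algebra_simps)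
      qed
      show "h \<le> c * (end_len k + (\<Sum>m\<leftarrow>ms. section_len m) + end_len k)"
        if "S \<in> orders M N" "D \<in> spacings (M + N) h" "0 \<le> c"
          "\<And>p. p \<in> {0..h} \<Longrightarrow> covered_at c S D p" for S D c
        using bound_from_secant[OF assms(1) that, of k] N q unfolding sum
        by (simp add: algebra_simps)
    qed (use assms k r odd \<open>1 \<le> q\<close> in \<open>auto simp: ms_def\<close>)
    moreover have "receiver_counts (deployed k ms k)
        = [(q + 1) div 2] @ replicate (r - 1) (q + 1) @ replicate (M - r) q @ [(q + 1) div 2]"
      using k by (simp add: receiver_counts_deployed ms_def)
    ultimately show ?thesis using odd by auto
  qed
qed

end
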